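(* Let $K$ be a field, $G$ a split connected reductive affine algebraic $K$-group, $T\subset G$ a $K$-split maximal torus, $W_\circ=N_G(T)(K)/T(K)$ its finite Weyl group and $\Phi$ its root system. Fix a simple system $\Delta\subset\Phi$ with corresponding positive system $\Pi$, and a realization $\{u_a\}_{a\in\Phi}$ of $\Phi$ in $G$, and let $\mathcal{N}_\circ:W_\circ\to N_G(T)(K)$ be the resulting Canonical Section. For $u,v\in W_\circ$ set $$\mathcal{F}(u,v)=\{a\in\Pi : v(a)\in-\Pi,\ u(v(a))\in\Pi\}.$$ Then for all $u,v\in W_\circ$, $$\mathcal{N}_\circ(u)\cdot\mathcal{N}_\circ(v)=\mathcal{N}_\circ(u\cdot v)\cdot\prod_{a\in\mathcal{F}(u,v)}a^\vee(-1).$$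
   Context: For $a\in\Phi$, $a^\vee$ is the corresponding coroot (a cocharacter of $T$), $s_a\in W_\circ$ the reflection, and $U_a\subset G$ the root subgroup. A realization of $\Phi$ in $G$ (in the sense of Springer's book "Linear Algebraic Groups") is a family of isomorphisms $u_a:\mathbf{G}_a\to U_a$ ($a\in\Phi$), where $\mathbf{G}_a$ is the additive group, such that $t\,u_a(x)\,t^{-1}=u_a(a(t)x)$ for $t \in T$, the element $n_a:=u_a(1)u_{-a}(-1)u_a(1)$ lies in $N_G(T)(K)$ and represents $s_a$, and $u_a(x)u_{-a}(-x^{-1})u_a(x)=a^\vee(x)n_a$ for invertible $x$. Canonical Section: for $w\in W_\circ$ with a reduced expression $w=s_{a_1}\cdots s_{a_\ell}$ ($a_i\in\Delta$), put $\mathcal{N}_\circ(w):=n_{a_1}\cdots n_{a_\ell}$; because the $n_a$ ($a\in\Delta$) satisfy the braid relations this is independent of the chosen reduced expression. It is a section of $N_G(T)(K)\to W_\circ$, in general not a homomorphism. It satisfies $\mathcal{N}_\circ(s_a)^2=a^\vee(-1)$ for $a\in\Delta$, and $\mathcal{N}_\circ(uv)=\mathcal{N}_\circ(u)\mathcal{N}_\circ(v)$ whenever $\ell(uv)=\ell(u)+\ell(v)$, where $\ell$ is the length function with respect to $\Delta$. *)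

theory Defs
  imports "HOL-Algebra.Algebraic_Closure_Type" "HOL-Algebra.Coset" "HOL-Algebra.FiniteProduct"
begin

text \<open>
  Algebraic groups are treated in the classical language of Springer's book: varieties are their
  point sets over an algebraically closed field \<^typ>\<open>'l\<close>, and structures over a subfield \<open>F\<close> are
  expressed by polynomials with coefficients in \<open>F\<close>. All affine spaces live in the single type
  \<^typ>\<open>nat \<Rightarrow> 'l\<close>; points of affine \<open>n\<close>-space vanish at all indices \<open>\<ge> n\<close>. As \<^typ>\<open>'l\<close> is infinite,
  polynomials may be identified with polynomial functions.
\<close>

type_synonym 'l point = "nat \<Rightarrow> 'l"


subsection \<open>Affine varieties\<close>

inductive_set polyfun :: "'l::field set \<Rightarrow> ('l point \<Rightarrow> 'l) set" for F where
  const: "c \<in> F \<Longrightarrow> (\<lambda>x. c) \<in> polyfun F"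
| coord: "(\<lambda>x. x i) \<in> polyfun F"
| add: "p \<in> polyfun F \<Longrightarrow> q \<in> polyfun F \<Longrightarrow> (\<lambda>x. p x + q x) \<in> polyfun F"
| mult: "p \<in> polyfun F \<Longrightarrow> q \<in> polyfun F \<Longrightarrow> (\<lambda>x. p x * q x) \<in> polyfun F"

definition affine_space :: "nat \<Rightarrow> 'l::field point set" where
  "affine_space n = {x. \<forall>i\<ge>n. x i = 0}"

definition zariski_closed :: "'l::field point set \<Rightarrow> bool" where
  "zariski_closed Z \<longleftrightarrow>
     (\<exists>n S. S \<subseteq> polyfun UNIV \<and> Z = {x \<in> affine_space n. \<forall>p\<in>S. p x = 0})"

text \<open>The vanishing ideal of \<open>Z\<close> is spanned by polynomials with coefficients in \<open>F\<close>.\<close>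

definition defined_over :: "'l::field set \<Rightarrow> 'l point set \<Rightarrow> bool" where
  "defined_over F Z \<longleftrightarrow>
     (\<forall>p\<in>polyfun UNIV. (\<forall>x\<in>Z. p x = 0) \<longrightarrow>
        (\<exists>(m::nat) c q. (\<forall>j<m. q j \<in> polyfun F \<and> (\<forall>x\<in>Z. q j x = 0)) \<and>
           p = (\<lambda>x. \<Sum>j<m. c j * q j x)))"

definition zariski_connected :: "'l::field point set \<Rightarrow> bool" where
  "zariski_connected Z \<longleftrightarrow>
     \<not> (\<exists>A B. zariski_closed A \<and> zariski_closed B \<and> A \<noteq> {} \<and> B \<noteq> {} \<and> A \<inter> B = {} \<and> Z = A \<union> B)"

definition regular_map :: "'l::field set \<Rightarrow> 'l point set \<Rightarrow> ('l point \<Rightarrow> 'l point) \<Rightarrow> bool" where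
  "regular_map F Z f \<longleftrightarrow> (\<forall>i. \<exists>p\<in>polyfun F. \<forall>x\<in>Z. f x i = p x)"

definition coordinate_ring :: "'l::field point set \<Rightarrow> ('l point \<Rightarrow> 'l) set" where
  "coordinate_ring Z = (\<lambda>p. restrict p Z) ` polyfun UNIV"

definition rational_points :: "'l::field set \<Rightarrow> 'l point set \<Rightarrow> 'l point set" where
  "rational_points F Z = {x \<in> Z. \<forall>i. x i \<in> F}"

text \<open>A point of the product of two affine spaces, with interleaved coordinates.\<close>

definition interleave :: "'l point \<Rightarrow> 'l point \<Rightarrow> 'l point" where
  "interleave x y = (\<lambda>i. if even i then x (i div 2) else y (i div 2))"


subsection \<open>Affine algebraic groups\<close>

definition affine_alg_group :: "'l::field set \<Rightarrow> 'l point monoid \<Rightarrow> bool" where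
  "affine_alg_group F G \<longleftrightarrow>
     group G \<and> zariski_closed (carrier G) \<and> defined_over F (carrier G) \<and>
     (\<forall>i. \<exists>p\<in>polyfun F. \<forall>x\<in>carrier G. \<forall>y\<in>carrier G. (x \<otimes>\<^bsub>G\<^esub> y) i = p (interleave x y)) \<and>
     regular_map F (carrier G) (\<lambda>x. inv\<^bsub>G\<^esub> x) \<and>
     \<one>\<^bsub>G\<^esub> \<in> rational_points F (carrier G)"

definition alg_hom ::
  "'l::field set \<Rightarrow> 'l point monoid \<Rightarrow> 'l point monoid \<Rightarrow> ('l point \<Rightarrow> 'l point) \<Rightarrow> bool" where
  "alg_hom F G H f \<longleftrightarrow> f \<in> hom G H \<and> regular_map F (carrier G) f"

definition alg_iso ::
  "'l::field set \<Rightarrow> 'l point monoid \<Rightarrow> 'l point monoid \<Rightarrow> ('l point \<Rightarrow> 'l point) \<Rightarrow> bool" where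
  "alg_iso F G H f \<longleftrightarrow> alg_hom F G H f \<and>
     (\<exists>g. alg_hom F H G g \<and> (\<forall>x\<in>carrier G. g (f x) = x) \<and> (\<forall>y\<in>carrier H. f (g y) = y))"

definition closed_subgroup :: "'l::field point monoid \<Rightarrow> 'l point set \<Rightarrow> bool" where
  "closed_subgroup G H \<longleftrightarrow> subgroup H G \<and> zariski_closed H"

text \<open>The additive group, and the \<open>r\<close>-th power of the multiplicative group, the latter realized
  as the variety \<open>x\<^sub>2\<^sub>i x\<^sub>2\<^sub>i\<^sub>+\<^sub>1 = 1\<close> \<open>(i < r)\<close> in affine \<open>2r\<close>-space.\<close>

definition Ga :: "'l::field point monoid" where
  "Ga = \<lparr>carrier = affine_space 1, monoid.mult = (\<lambda>x y i. x i + y i), one = (\<lambda>i. 0)\<rparr>"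

definition Gm_pow :: "nat \<Rightarrow> 'l::field point monoid" where
  "Gm_pow r = \<lparr>carrier = {x \<in> affine_space (2 * r). \<forall>i<r. x (2 * i) * x (2 * i + 1) = 1},
               monoid.mult = (\<lambda>x y i. x i * y i), one = (\<lambda>i. if i < 2 * r then 1 else 0)\<rparr>"

definition gm_point :: "'l::field \<Rightarrow> 'l point" where
  "gm_point x = (\<lambda>i. if i = 0 then x else if i = 1 then inverse x else 0)"

text \<open>\<open>g\<close> is unipotent if right translation by \<open>g\<close> is a locally unipotent operator on the
  coordinate ring.\<close>

definition unipotent_elt :: "'l::field point monoid \<Rightarrow> 'l point \<Rightarrow> bool" where
  "unipotent_elt G g \<longleftrightarrow>
     (\<forall>f\<in>coordinate_ring (carrier G). \<exists>m.
        ((\<lambda>h. \<lambda>x\<in>carrier G. h (x \<otimes>\<^bsub>G\<^esub> g) - h x) ^^ m) f = (\<lambda>x\<in>carrier G. 0))"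

text \<open>Reductive: the unipotent radical (over the algebraically closed field) is trivial.\<close>

definition reductive :: "'l::field point monoid \<Rightarrow> bool" where
  "reductive G \<longleftrightarrow>
     (\<forall>H. closed_subgroup G H \<and> H \<lhd> G \<and> zariski_connected H \<and> (\<forall>h\<in>H. unipotent_elt G h)
        \<longrightarrow> H = {\<one>\<^bsub>G\<^esub>})"

text \<open>An \<open>F\<close>-split torus; for \<open>F = UNIV\<close>, simply a torus.\<close>

definition split_torus :: "'l::field set \<Rightarrow> 'l point monoid \<Rightarrow> 'l point set \<Rightarrow> bool" where
  "split_torus F G T \<longleftrightarrow> closed_subgroup G T \<and> defined_over F T \<and>
     (\<exists>r f. alg_iso F (Gm_pow r) (G\<lparr>carrier := T\<rparr>) f)"

definition split_maximal_torus :: "'l::field set \<Rightarrow> 'l point monoid \<Rightarrow> 'l point set \<Rightarrow> bool" where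
  "split_maximal_torus F G T \<longleftrightarrow> split_torus F G T \<and>
     (\<forall>S. split_torus UNIV G S \<and> T \<subseteq> S \<longrightarrow> S = T)"


subsection \<open>Characters, cocharacters, roots\<close>

type_synonym 'l chr = "'l point \<Rightarrow> 'l"
type_synonym 'l cochr = "'l \<Rightarrow> 'l point"

definition characters :: "'l::field point monoid \<Rightarrow> 'l point set \<Rightarrow> 'l chr set" where
  "characters G T = {a \<in> extensional T. alg_hom UNIV (G\<lparr>carrier := T\<rparr>) (Gm_pow 1) (\<lambda>t. gm_point (a t))}"

definition cocharacters :: "'l::field point monoid \<Rightarrow> 'l point set \<Rightarrow> 'l cochr set" where
  "cocharacters G T = {l \<in> extensional (- {0}). alg_hom UNIV (Gm_pow 1) (G\<lparr>carrier := T\<rparr>) (\<lambda>z. l (z 0))}"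

text \<open>The groups of characters and cocharacters are thought of additively:
  \<open>chr_neg T a\<close> is \<open>-a\<close>, \<open>chr_reflection T a l b\<close> is \<open>b - \<langle>b, l\<rangle> a\<close>, and
  \<open>cochr_reflection G a l m\<close> is \<open>m - \<langle>a, m\<rangle> l\<close>.\<close>

definition pairing :: "'l::field chr \<Rightarrow> 'l cochr \<Rightarrow> int" where
  "pairing a l = (THE k. \<forall>x. x \<noteq> 0 \<longrightarrow> a (l x) = x powi k)"

definition chr_neg :: "'l::field point set \<Rightarrow> 'l chr \<Rightarrow> 'l chr" where
  "chr_neg T a = (\<lambda>t\<in>T. inverse (a t))"

definition chr_reflection :: "'l::field point set \<Rightarrow> 'l chr \<Rightarrow> 'l cochr \<Rightarrow> 'l chr \<Rightarrow> 'l chr" where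
  "chr_reflection T a l b = (\<lambda>t\<in>T. b t * a t powi (- pairing b l))"

definition cochr_reflection ::
  "'l::field point monoid \<Rightarrow> 'l chr \<Rightarrow> 'l cochr \<Rightarrow> 'l cochr \<Rightarrow> 'l cochr" where
  "cochr_reflection G a l m = (\<lambda>x\<in>- {0}. m x \<otimes>\<^bsub>G\<^esub> l (x powi (- pairing a m)))"

text \<open>The Lie algebra, as the space of point derivations of the coordinate ring at the identity;
  conjugation by \<open>t\<close> acts on it through \<open>(Ad t D) f = D (f \<circ> Int t)\<close>.\<close>

definition lie_algebra :: "'l::field point monoid \<Rightarrow> (('l point \<Rightarrow> 'l) \<Rightarrow> 'l) set" where
  "lie_algebra G = {D.
     (\<forall>f\<in>coordinate_ring (carrier G). \<forall>g\<in>coordinate_ring (carrier G).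
        D (\<lambda>x\<in>carrier G. f x + g x) = D f + D g \<and>
        D (\<lambda>x\<in>carrier G. f x * g x) = f \<one>\<^bsub>G\<^esub> * D g + D f * g \<one>\<^bsub>G\<^esub>) \<and>
     (\<forall>f\<in>coordinate_ring (carrier G). \<forall>c. D (\<lambda>x\<in>carrier G. c * f x) = c * D f)}"

definition roots :: "'l::field point monoid \<Rightarrow> 'l point set \<Rightarrow> 'l chr set" where
  "roots G T = {a \<in> characters G T. a \<noteq> (\<lambda>t\<in>T. 1) \<and>
     (\<exists>D\<in>lie_algebra G. (\<exists>f\<in>coordinate_ring (carrier G). D f \<noteq> 0) \<and>
        (\<forall>t\<in>T. \<forall>f\<in>coordinate_ring (carrier G).
           D (\<lambda>x\<in>carrier G. f (t \<otimes>\<^bsub>G\<^esub> x \<otimes>\<^bsub>G\<^esub> inv\<^bsub>G\<^esub> t)) = a t * D f))}"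

text \<open>With the coroot map \<open>cr\<close>, the roots form a reduced root datum in the character and
  cocharacter groups of \<open>T\<close>.\<close>

definition reduced_root_datum ::
  "'l::field point monoid \<Rightarrow> 'l point set \<Rightarrow> ('l chr \<Rightarrow> 'l cochr) \<Rightarrow> bool" where
  "reduced_root_datum G T cr \<longleftrightarrow>
     finite (roots G T) \<and> cr ` roots G T \<subseteq> cocharacters G T \<and> inj_on cr (roots G T) \<and>
     (\<forall>a\<in>roots G T. pairing a (cr a) = 2 \<and>
        chr_reflection T a (cr a) ` roots G T = roots G T \<and>
        cochr_reflection G a (cr a) ` cr ` roots G T = cr ` roots G T) \<and>
     (\<forall>a\<in>roots G T. \<forall>b\<in>roots G T. \<forall>(m::int) (n::int).
        m \<noteq> 0 \<and> (\<forall>t\<in>T. b t powi m = a t powi n) \<longrightarrow> b = a \<or> b = chr_neg T a)"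

definition nonneg_combs :: "'l::field point set \<Rightarrow> 'l chr set \<Rightarrow> 'l chr set" where
  "nonneg_combs T \<Delta> = {a. \<exists>c :: 'l chr \<Rightarrow> nat. a = (\<lambda>t\<in>T. \<Prod>b\<in>\<Delta>. b t ^ c b)}"

definition positive_system ::
  "'l::field point monoid \<Rightarrow> 'l point set \<Rightarrow> 'l chr set \<Rightarrow> 'l chr set" where
  "positive_system G T \<Delta> = roots G T \<inter> nonneg_combs T \<Delta>"

definition simple_system :: "'l::field point monoid \<Rightarrow> 'l point set \<Rightarrow> 'l chr set \<Rightarrow> bool" where
  "simple_system G T \<Delta> \<longleftrightarrow> \<Delta> \<subseteq> roots G T \<and> finite \<Delta> \<and>
     (\<forall>c :: 'l chr \<Rightarrow> int. (\<forall>t\<in>T. (\<Prod>b\<in>\<Delta>. b t powi c b) = 1) \<longrightarrow> (\<forall>b\<in>\<Delta>. c b = 0)) \<and>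
     (\<forall>a\<in>roots G T. a \<in> nonneg_combs T \<Delta> \<or> chr_neg T a \<in> nonneg_combs T \<Delta>)"


subsection \<open>The Weyl group\<close>

definition normalizer_points ::
  "'l::field set \<Rightarrow> 'l point monoid \<Rightarrow> 'l point set \<Rightarrow> 'l point set" where
  "normalizer_points F G T =
     {g \<in> rational_points F (carrier G). (\<lambda>t. g \<otimes>\<^bsub>G\<^esub> t \<otimes>\<^bsub>G\<^esub> inv\<^bsub>G\<^esub> g) ` T = T}"

definition weyl_group ::
  "'l::field set \<Rightarrow> 'l point monoid \<Rightarrow> 'l point set \<Rightarrow> 'l point set monoid" where
  "weyl_group F G T = G\<lparr>carrier := normalizer_points F G T\<rparr> Mod rational_points F T"

text \<open>The action \<open>(w a)(t) = a(n\<^sup>-\<^sup>1 t n)\<close> for any representative \<open>n \<in> w\<close>.\<close>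

definition weyl_act ::
  "'l::field point monoid \<Rightarrow> 'l point set \<Rightarrow> 'l point set \<Rightarrow> 'l chr \<Rightarrow> 'l chr" where
  "weyl_act G T w a = (let n = (SOME n. n \<in> w) in (\<lambda>t\<in>T. a (inv\<^bsub>G\<^esub> n \<otimes>\<^bsub>G\<^esub> t \<otimes>\<^bsub>G\<^esub> n)))"

definition is_weyl_reflection ::
  "'l::field set \<Rightarrow> 'l point monoid \<Rightarrow> 'l point set \<Rightarrow> ('l chr \<Rightarrow> 'l cochr) \<Rightarrow>
   'l chr \<Rightarrow> 'l point set \<Rightarrow> bool" where
  "is_weyl_reflection F G T cr a w \<longleftrightarrow> w \<in> carrier (weyl_group F G T) \<and>
     (\<forall>b\<in>characters G T. weyl_act G T w b = chr_reflection T a (cr a) b)"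

definition group_word :: "('g, 'm) monoid_scheme \<Rightarrow> ('a \<Rightarrow> 'g) \<Rightarrow> 'a list \<Rightarrow> 'g" where
  "group_word G s as = foldr (\<lambda>a g. s a \<otimes>\<^bsub>G\<^esub> g) as \<one>\<^bsub>G\<^esub>"

definition reduced_expression :: "('g, 'm) monoid_scheme \<Rightarrow> ('a \<Rightarrow> 'g) \<Rightarrow> 'a set \<Rightarrow> 'g \<Rightarrow> 'a list \<Rightarrow> bool"
  where
  "reduced_expression W s \<Delta> w as \<longleftrightarrow> as \<in> lists \<Delta> \<and> group_word W s as = w \<and>
     (\<forall>bs\<in>lists \<Delta>. group_word W s bs = w \<longrightarrow> length as \<le> length bs)"


subsection \<open>Realizations and the canonical section\<close>

definition equivariant_Ga :: "'l::field set \<Rightarrow> 'l point monoid \<Rightarrow> 'l point set \<Rightarrow> 'l chr \<Rightarrow>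
   'l point set \<Rightarrow> ('l \<Rightarrow> 'l point) \<Rightarrow> bool" where
  "equivariant_Ga F G T a U u \<longleftrightarrow>
     closed_subgroup G U \<and> alg_iso F Ga (G\<lparr>carrier := U\<rparr>) (\<lambda>z. u (z 0)) \<and>
     (\<forall>t\<in>T. \<forall>x. t \<otimes>\<^bsub>G\<^esub> u x \<otimes>\<^bsub>G\<^esub> inv\<^bsub>G\<^esub> t = u (a t * x))"

text \<open>The root subgroup of \<open>a\<close> is the unique closed subgroup isomorphic to the additive group on
  which \<open>T\<close> acts through \<open>a\<close>.\<close>

definition is_root_subgroup ::
  "'l::field point monoid \<Rightarrow> 'l point set \<Rightarrow> 'l chr \<Rightarrow> 'l point set \<Rightarrow> bool" where
  "is_root_subgroup G T a U \<longleftrightarrow> (\<forall>V. (\<exists>u. equivariant_Ga UNIV G T a V u) \<longleftrightarrow> V = U)"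

definition root_triple :: "'l::field point monoid \<Rightarrow> 'l point set \<Rightarrow> ('l chr \<Rightarrow> 'l \<Rightarrow> 'l point) \<Rightarrow>
   'l chr \<Rightarrow> 'l \<Rightarrow> 'l point" where
  "root_triple G T u a x =
     u a x \<otimes>\<^bsub>G\<^esub> u (chr_neg T a) (- inverse x) \<otimes>\<^bsub>G\<^esub> u a x"

abbreviation root_rep :: "'l::field point monoid \<Rightarrow> 'l point set \<Rightarrow> ('l chr \<Rightarrow> 'l \<Rightarrow> 'l point) \<Rightarrow>
   'l chr \<Rightarrow> 'l point" where
  "root_rep G T u a \<equiv> root_triple G T u a 1"

definition realization :: "'l::field set \<Rightarrow> 'l point monoid \<Rightarrow> 'l point set \<Rightarrow>
   ('l chr \<Rightarrow> 'l cochr) \<Rightarrow> ('l chr \<Rightarrow> 'l point set) \<Rightarrow> ('l chr \<Rightarrow> 'l \<Rightarrow> 'l point) \<Rightarrow> bool" where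
  "realization F G T cr s u \<longleftrightarrow>
     (\<forall>a\<in>roots G T.
        (\<exists>U. is_root_subgroup G T a U \<and> equivariant_Ga F G T a U (u a)) \<and>
        root_rep G T u a \<in> normalizer_points F G T \<and> root_rep G T u a \<in> s a \<and>
        (\<forall>x. x \<noteq> 0 \<longrightarrow> root_triple G T u a x = cr a x \<otimes>\<^bsub>G\<^esub> root_rep G T u a))"

text \<open>\<open>N\<close> is the map on the Weyl group whose value at \<open>w\<close> is computed from a reduced expression
  of \<open>w\<close> in the simple reflections, with a result that does not depend on the expression.\<close>

definition canonical_section :: "'l::field set \<Rightarrow> 'l point monoid \<Rightarrow> 'l point set \<Rightarrow> 'l chr set \<Rightarrow>
   ('l chr \<Rightarrow> 'l point set) \<Rightarrow> ('l chr \<Rightarrow> 'l \<Rightarrow> 'l point) \<Rightarrow> ('l point set \<Rightarrow> 'l point) \<Rightarrow> bool" where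
  "canonical_section F G T \<Delta> s u N \<longleftrightarrow>
     (\<forall>w\<in>carrier (weyl_group F G T). \<forall>n. N w = n \<longleftrightarrow>
        (\<exists>as. reduced_expression (weyl_group F G T) s \<Delta> w as \<and>
              n = group_word G (root_rep G T u) as))"

definition flip_set :: "'l::field point monoid \<Rightarrow> 'l point set \<Rightarrow> 'l chr set \<Rightarrow>
   'l point set \<Rightarrow> 'l point set \<Rightarrow> 'l chr set" where
  "flip_set G T \<Delta> v w = {a \<in> positive_system G T \<Delta>.
     weyl_act G T w a \<in> chr_neg T ` positive_system G T \<Delta> \<and>
     weyl_act G T v (weyl_act G T w a) \<in> positive_system G T \<Delta>}"

end

theory Submission
  imports Defs
begin

text \<open>
  The formula is proved by induction on the length of \<open>v\<close>, splitting off the last letter \<open>s\<^sub>a\<close> of a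
  reduced expression \<open>v = v' s\<^sub>a\<close>. If \<open>s\<^sub>a w\<close> is longer than \<open>w\<close>, then \<open>n\<^sub>a\<close> is absorbed into \<open>N w\<close>
  and the flip set of \<open>(v, w)\<close> equals that of \<open>(v', s\<^sub>a w)\<close>. Otherwise \<open>w = s\<^sub>a w'\<close>, the two adjacent
  factors \<open>n\<^sub>a\<close> give \<open>n\<^sub>a\<^sup>2 = a\<^sup>\<or>(-1)\<close>, and moving this past \<open>N w'\<close> contributes the coroot of
  \<open>w'\<^sup>-\<^sup>1 a\<close>, which is the only additional element of the flip set.

  This needs the exchange condition and the equivariance of coroots in the group \<open>W = N(T)(K) / T(K)\<close>.
  The usual argument rests on the fact that \<open>W\<close> acts faithfully on \<open>T\<close>, that is, that \<open>T\<close> is its own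
  centralizer. Instead, both are derived from the realization: an element \<open>n\<close> of the normalizer
  with \<open>n a = b\<close> maps \<open>u\<^sub>a(x)\<close> to \<open>u\<^sub>b(c x)\<close> and \<open>u\<^sub>-\<^sub>a(x)\<close> to \<open>u\<^sub>-\<^sub>b(d x)\<close>, and a computation with the
  subgroups for \<open>b\<close> and \<open>-b\<close> forces \<open>c d = 1\<close>. Hence \<open>n n\<^sub>a n\<^sup>-\<^sup>1\<close> is \<open>b\<^sup>\<or>(c) n\<^sub>b\<close>.
\<close>

subsection \<open>The exchange condition and flip sets\<close>

lemma group_word_simps [simp]:
  "group_word G s [] = \<one>\<^bsub>G\<^esub>"
  "group_word G s (a # as) = s a \<otimes>\<^bsub>G\<^esub> group_word G s as"
  by (simp_all add: group_word_def)

context group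
begin

lemma group_word_closed:
  "\<lbrakk>as \<in> lists \<Delta>; \<And>a. a \<in> \<Delta> \<Longrightarrow> s a \<in> carrier G\<rbrakk> \<Longrightarrow> group_word G s as \<in> carrier G"
  by (induction as) auto

lemma group_word_append:
  assumes "as \<in> lists \<Delta>" "bs \<in> lists \<Delta>" "\<And>a. a \<in> \<Delta> \<Longrightarrow> s a \<in> carrier G"
  shows "group_word G s (as @ bs) = group_word G s as \<otimes> group_word G s bs"
  using assms(1)
proof induction
  case Nil
  then show ?case using group_word_closed[of bs \<Delta> s] assms(2,3) by simp
next
  case (Cons a as)
  then show ?case
    using group_word_closed[of as \<Delta> s] group_word_closed[of bs \<Delta> s] assms(2,3)
    by (simp add: m_assoc)
qed

lemma inv_group_word:
  assumes "as \<in> lists \<Delta>" "\<And>a. a \<in> \<Delta> \<Longrightarrow> s a \<in> carrier G" "\<And>a. a \<in> \<Delta> \<Longrightarrow> s a \<otimes> s a = \<one>"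
  shows "inv (group_word G s as) = group_word G s (rev as)"
  using assms(1)
proof (induction as)
  case (Cons a as)
  then have a: "a \<in> \<Delta>" "as \<in> lists \<Delta>" by auto
  then have "inv (s a) = s a"
    using assms(2,3) by (simp add: inv_equality)
  with a Cons.IH show ?case
    using assms(2) group_word_append[of "rev as" \<Delta> "[a]" s]
    by (simp add: inv_mult_group group_word_closed[of _ \<Delta>] in_lists_conv_set)
qed simp

end

section \<open>Reduced expressions and the exchange condition\<close>

lemma reduced_expressionD:
  assumes "reduced_expression W s \<Delta> w as"
  shows "as \<in> lists \<Delta>" "group_word W s as = w"
    "\<And>bs. bs \<in> lists \<Delta> \<Longrightarrow> group_word W s bs = w \<Longrightarrow> length as \<le> length bs"
  using assms by (auto simp: reduced_expression_def)

text \<open>Only the properties of a root system that the exchange condition needs; in particular the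
  action of the group on the roots is not assumed to be faithful.\<close>

locale reflection_action = group W for W :: "('b, 'c) monoid_scheme" (structure) +
  fixes \<Phi> Pos \<Delta> :: "'a set" and neg :: "'a \<Rightarrow> 'a" and s :: "'a \<Rightarrow> 'b" and act :: "'b \<Rightarrow> 'a \<Rightarrow> 'a"
  assumes \<Delta>_subset: "\<Delta> \<subseteq> Pos" and Pos_subset: "Pos \<subseteq> \<Phi>"
    and s_closed: "\<And>a. a \<in> \<Phi> \<Longrightarrow> s a \<in> carrier W"
    and act_closed: "\<And>w a. w \<in> carrier W \<Longrightarrow> a \<in> \<Phi> \<Longrightarrow> act w a \<in> \<Phi>"
    and act_mult: "\<And>v w a. v \<in> carrier W \<Longrightarrow> w \<in> carrier W \<Longrightarrow> a \<in> \<Phi> \<Longrightarrow>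
      act (v \<otimes> w) a = act v (act w a)"
    and act_one: "\<And>a. a \<in> \<Phi> \<Longrightarrow> act \<one> a = a"
    and act_neg: "\<And>w a. w \<in> carrier W \<Longrightarrow> a \<in> \<Phi> \<Longrightarrow> act w (neg a) = neg (act w a)"
    and neg_closed: "\<And>a. a \<in> \<Phi> \<Longrightarrow> neg a \<in> \<Phi>"
    and neg_neg: "\<And>a. a \<in> \<Phi> \<Longrightarrow> neg (neg a) = a"
    and neg_pos_iff: "\<And>a. a \<in> \<Phi> \<Longrightarrow> neg a \<in> Pos \<longleftrightarrow> a \<notin> Pos"
    and act_simple: "\<And>a. a \<in> \<Delta> \<Longrightarrow> act (s a) a = neg a"
    and act_simple_pos: "\<And>a b. a \<in> \<Delta> \<Longrightarrow> b \<in> Pos \<Longrightarrow> b \<noteq> a \<Longrightarrow> act (s a) b \<in> Pos"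
    and s_square: "\<And>a. a \<in> \<Delta> \<Longrightarrow> s a \<otimes> s a = \<one>"
    and s_conj: "\<And>w a. w \<in> carrier W \<Longrightarrow> a \<in> \<Phi> \<Longrightarrow> s (act w a) \<otimes> w = w \<otimes> s a"
    and generated: "\<And>w. w \<in> carrier W \<Longrightarrow> \<exists>as. reduced_expression W s \<Delta> w as"
begin

lemma \<Delta>_root: "a \<in> \<Delta> \<Longrightarrow> a \<in> \<Phi>"
  using \<Delta>_subset Pos_subset by blast

lemma s_simple_closed: "a \<in> \<Delta> \<Longrightarrow> s a \<in> carrier W"
  by (simp add: \<Delta>_root s_closed)

lemma word_closed: "as \<in> lists \<Delta> \<Longrightarrow> group_word W s as \<in> carrier W"
  by (rule group_word_closed) (auto simp: s_simple_closed)

lemma s_cancel: "a \<in> \<Delta> \<Longrightarrow> w \<in> carrier W \<Longrightarrow> s a \<otimes> (s a \<otimes> w) = w"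
  using s_square s_simple_closed by (metis m_assoc l_one)

lemma inv_s: "a \<in> \<Delta> \<Longrightarrow> inv (s a) = s a"
  by (simp add: inv_equality s_square s_simple_closed)

lemma act_inv_act:
  "w \<in> carrier W \<Longrightarrow> a \<in> \<Phi> \<Longrightarrow> act (inv w) (act w a) = a"
  "w \<in> carrier W \<Longrightarrow> a \<in> \<Phi> \<Longrightarrow> act w (act (inv w) a) = a"
  using act_mult[of "inv w" w a] act_mult[of w "inv w" a] act_one by simp_all

lemma neg_image_iff: "a \<in> \<Phi> \<Longrightarrow> a \<in> neg ` Pos \<longleftrightarrow> a \<notin> Pos"
  using neg_neg neg_pos_iff neg_closed Pos_subset by (smt (verit) image_iff subsetD)

lemma act_simple_iff:
  assumes "a \<in> \<Delta>" "b \<in> \<Phi>" "b \<noteq> a" "b \<noteq> neg a"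
  shows "act (s a) b \<in> Pos \<longleftrightarrow> b \<in> Pos"
proof (cases "b \<in> Pos")
  case False
  then have "neg b \<in> Pos" "neg b \<noteq> a"
    using assms neg_pos_iff neg_neg by auto
  then have "act (s a) (neg b) \<in> Pos"
    using assms act_simple_pos by simp
  then have "neg (act (s a) b) \<in> Pos"
    using assms act_neg s_simple_closed by simp
  then show ?thesis
    using False assms neg_pos_iff act_closed s_simple_closed by simp
qed (use assms act_simple_pos in simp)

text \<open>The root \<open>c\<close> is carried through the word letter by letter. While it differs
  from the current letter \<open>b\<close>, its image under \<open>s b\<close> stays positive, and
  \<open>s_conj\<close> lets \<open>s c\<close> pass \<open>s b\<close>, becoming the reflection in
  that image. Since the root ends up negative, it must at some point equal the current letter; there
  the two equal reflections cancel and the letter is deleted.\<close>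

lemma exchange:
  assumes "as \<in> lists \<Delta>" "c \<in> Pos" "act (inv (group_word W s as)) c \<notin> Pos"
  shows "\<exists>as'\<in>lists \<Delta>. length as = Suc (length as') \<and>
    s c \<otimes> group_word W s as = group_word W s as'"
  using assms
proof (induction as arbitrary: c rule: list.induct)
  case Nil
  then show ?case using act_one Pos_subset by auto
next
  case (Cons b bs)
  then have b: "b \<in> \<Delta>" and bs: "bs \<in> lists \<Delta>" and c: "c \<in> \<Phi>"
    using Pos_subset by auto
  let ?w = "group_word W s bs"
  note closed = word_closed[OF bs] s_simple_closed[OF b]
  show ?case
  proof (cases "c = b")
    case True
    then show ?thesis
      using bs b closed s_cancel by (intro bexI[of _ bs]) auto
  next
    case False
    let ?c' = "act (s b) c"
    have c': "?c' \<in> Pos"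
      using act_simple_pos b False Cons.prems by simp
    have "act (inv ?w) ?c' \<notin> Pos"
      using Cons.prems(3) closed c by (simp add: inv_mult_group inv_s b act_mult)
    from Cons.IH[OF bs c' this] obtain as' where as': "as' \<in> lists \<Delta>"
      "length bs = Suc (length as')" "s ?c' \<otimes> ?w = group_word W s as'" by blast
    have "s ?c' \<otimes> s b = s b \<otimes> s c"
      using s_conj closed c by simp
    then have "s b \<otimes> (s ?c' \<otimes> s b) = s c"
      using s_cancel b s_closed c by simp
    then have "s c \<otimes> (s b \<otimes> ?w) = s b \<otimes> (s ?c' \<otimes> (s b \<otimes> (s b \<otimes> ?w)))"
      using closed s_closed act_closed c by (simp add: m_assoc[symmetric])
    also have "\<dots> = group_word W s (b # as')"
      using s_cancel b closed as' by simp
    finally show ?thesis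
      using as' b by (intro bexI[of _ "b # as'"]) auto
  qed
qed

text \<open>Otherwise \<open>exchange\<close> rewrites \<open>w\<close>, which is \<open>s a\<close>
  times the word \<open>as\<close>, as a word two letters shorter than
  \<open>a # as\<close>.\<close>

lemma reduced_Cons_pos:
  assumes "reduced_expression W s \<Delta> w (a # as)"
  shows "act (inv (group_word W s as)) a \<in> Pos"
proof (rule ccontr)
  assume *: "act (inv (group_word W s as)) a \<notin> Pos"
  have "a \<in> \<Delta>" "as \<in> lists \<Delta>"
    using reduced_expressionD(1)[OF assms] by auto
  then obtain as' where "as' \<in> lists \<Delta>" "length as = Suc (length as')"
    "s a \<otimes> group_word W s as = group_word W s as'"
    using exchange[OF _ _ *] \<Delta>_subset by auto
  then show False
    using reduced_expressionD(2)[OF assms] reduced_expressionD(3)[OF assms, of as'] by simp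
qed

text \<open>Words in involutions are inverted by reversal, which keeps the length. This carries
  facts about the first letter of a reduced word over to the last one.\<close>

lemma reduced_rev:
  assumes "reduced_expression W s \<Delta> w as"
  shows "reduced_expression W s \<Delta> (inv w) (rev as)"
  unfolding reduced_expression_def
proof (intro conjI ballI impI)
  show "rev as \<in> lists \<Delta>"
    using reduced_expressionD(1)[OF assms] by (simp add: in_lists_conv_set)
  show "group_word W s (rev as) = inv w"
    using inv_group_word[of as \<Delta> s] reduced_expressionD[OF assms] s_square s_simple_closed by simp
  fix bs
  assume bs: "bs \<in> lists \<Delta>" "group_word W s bs = inv w"
  have "w \<in> carrier W"
    using reduced_expressionD(1,2)[OF assms] word_closed by blast
  then have "group_word W s (rev bs) = w"
    using inv_group_word[of bs \<Delta> s] bs s_square s_simple_closed by simp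
  then show "length (rev as) \<le> length bs"
    using reduced_expressionD(3)[OF assms, of "rev bs"] bs by (simp add: in_lists_conv_set)
qed

lemma reduced_snoc_pos:
  assumes "reduced_expression W s \<Delta> w (as @ [a])"
  shows "act (group_word W s as) a \<in> Pos"
proof -
  have as: "as \<in> lists \<Delta>"
    using reduced_expressionD(1)[OF assms] by simp
  have "act (inv (group_word W s (rev as))) a \<in> Pos"
    using reduced_Cons_pos reduced_rev[OF assms] by simp
  then show ?thesis
    using inv_group_word[of "rev as" \<Delta> s] as s_square s_simple_closed
    by (simp add: in_lists_conv_set)
qed

lemma reduced_snocD:
  assumes "reduced_expression W s \<Delta> w (as @ [a])"
  shows "reduced_expression W s \<Delta> (group_word W s as) as"
  unfolding reduced_expression_def
proof (intro conjI ballI impI)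
  show as: "as \<in> lists \<Delta>"
    using reduced_expressionD(1)[OF assms] by simp
  have a: "[a] \<in> lists \<Delta>"
    using reduced_expressionD(1)[OF assms] by simp
  fix bs
  assume bs: "bs \<in> lists \<Delta>" "group_word W s bs = group_word W s as"
  then have "group_word W s (bs @ [a]) = w"
    using reduced_expressionD(2)[OF assms] as a group_word_append[of _ \<Delta> "[a]" s] s_simple_closed
    by simp
  then show "length as \<le> length bs"
    using reduced_expressionD(3)[OF assms, of "bs @ [a]"] bs a by simp
qed simp

lemma reduced_ConsD:
  assumes "reduced_expression W s \<Delta> w (a # as)"
  shows "reduced_expression W s \<Delta> (group_word W s as) as"
  using reduced_expressionD(1,2)[OF assms] reduced_expressionD(3)[OF assms, of "a # bs" for bs]
  by (auto simp: reduced_expression_def)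

text \<open>\<open>exchange\<close> gives a word for \<open>s a\<close> times \<open>w\<close> that
  is one letter shorter than \<open>bs\<close>. Putting \<open>a\<close> back in front yields a word
  for \<open>w\<close> of the minimal length again.\<close>

lemma reduced_Cons_if_neg:
  assumes "reduced_expression W s \<Delta> w bs" "a \<in> \<Delta>" "act (inv w) a \<notin> Pos"
  shows "\<exists>as. reduced_expression W s \<Delta> w (a # as) \<and> group_word W s as = s a \<otimes> w"
proof -
  have w: "w \<in> carrier W"
    using reduced_expressionD(1,2)[OF assms(1)] word_closed by blast
  obtain as where as: "as \<in> lists \<Delta>" "length bs = Suc (length as)" "s a \<otimes> w = group_word W s as"
    using exchange[of bs a] reduced_expressionD[OF assms(1)] assms \<Delta>_subset by auto
  moreover have "s a \<otimes> group_word W s as = w"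
    using as(3) s_cancel[of a w] assms w by simp
  ultimately show ?thesis
    using reduced_expressionD(3)[OF assms(1)] assms(2) by (auto simp: reduced_expression_def)
qed

text \<open>Passing from \<open>w\<close> to \<open>s a\<close> times \<open>w\<close> makes the
  root negative, so the previous lemma provides a reduced word \<open>a # ds\<close> for the
  product. Its tail \<open>ds\<close> is a word for \<open>w\<close>, hence not shorter than
  \<open>bs\<close>, and so \<open>a # bs\<close> is minimal as well.\<close>

lemma reduced_Cons_if_pos:
  assumes "reduced_expression W s \<Delta> w bs" "a \<in> \<Delta>" "act (inv w) a \<in> Pos"
  shows "reduced_expression W s \<Delta> (s a \<otimes> w) (a # bs)"
proof -
  have w: "w \<in> carrier W"
    using reduced_expressionD(1,2)[OF assms(1)] word_closed by blast
  note sa = s_simple_closed[OF assms(2)]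
  obtain cs where cs: "reduced_expression W s \<Delta> (s a \<otimes> w) cs"
    using generated w sa by blast
  have "act (inv (s a \<otimes> w)) a = neg (act (inv w) a)"
    using w sa \<Delta>_root[OF assms(2)]
    by (simp add: inv_mult_group inv_s assms act_mult act_simple act_neg)
  then have "act (inv (s a \<otimes> w)) a \<notin> Pos"
    using neg_pos_iff assms(3) Pos_subset by auto
  then obtain ds where ds: "reduced_expression W s \<Delta> (s a \<otimes> w) (a # ds)"
    "group_word W s ds = s a \<otimes> (s a \<otimes> w)"
    using reduced_Cons_if_neg[OF cs assms(2)] by blast
  then have "length bs \<le> length ds"
    using reduced_expressionD(3)[OF assms(1), of ds] s_cancel assms(2) w
      reduced_expressionD(1)[OF ds(1)] by simp
  then show ?thesis
    using reduced_expressionD[OF assms(1)] reduced_expressionD(3)[OF ds(1)] assms(2)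
    by (fastforce simp: reduced_expression_def)
qed

section \<open>Flip sets and their change under a simple reflection\<close>

definition flips :: "'b \<Rightarrow> 'b \<Rightarrow> 'a set" where
  "flips v w = {a \<in> Pos. act w a \<notin> Pos \<and> act v (act w a) \<in> Pos}"

lemma flips_one: "w \<in> carrier W \<Longrightarrow> flips \<one> w = {}"
  using act_one act_closed Pos_subset by (auto simp: flips_def)

context
  fixes v w a
  assumes v: "v \<in> carrier W" and w: "w \<in> carrier W" and a: "a \<in> \<Delta>"
    and va: "act v a \<in> Pos" and wa: "act (inv w) a \<in> Pos"
begin

text \<open>Such a \<open>b\<close> would be the negative of the positive root
  \<open>act (inv w) a\<close>. With \<open>act_simple_iff\<close> this leaves
  \<open>act w b = a\<close> as the only case in which \<open>s a\<close> changes a sign.\<close>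

lemma not_neg_simple: "b \<in> Pos \<Longrightarrow> act w b \<noteq> neg a"
proof
  assume b: "b \<in> Pos" "act w b = neg a"
  then have "b = neg (act (inv w) a)"
    using act_inv_act(1)[OF w, of b] act_neg[of "inv w" a] w a Pos_subset \<Delta>_root by auto
  then show False
    using b wa neg_pos_iff Pos_subset by auto
qed

lemma act_w_eq_iff: "b \<in> Pos \<Longrightarrow> act w b = a \<longleftrightarrow> b = act (inv w) a"
  using act_inv_act w a Pos_subset \<Delta>_root by auto

lemma act_v_neg: "act v (neg a) \<notin> Pos"
  using va v a neg_pos_iff act_neg act_closed \<Delta>_root by simp

lemma act_word_simps:
  assumes "b \<in> Pos"
  shows "act (v \<otimes> s a) (act w b) = act v (act (s a) (act w b))"
    "act (s a \<otimes> w) b = act (s a) (act w b)"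
    "act (s a) (act (s a) (act w b)) = act w b"
  using assms v w s_simple_closed[OF a] act_closed Pos_subset act_inv_act(1)[of "s a" "act w b"]
  by (auto simp: act_mult inv_s a)

text \<open>Only the root \<open>b\<close> with \<open>act w b = a\<close> needs care, and it lies
  in neither set: on the left its first image \<open>a\<close> is positive, on the right its first
  image is \<open>neg a\<close> and \<open>v\<close> keeps that negative.\<close>

lemma flips_move: "flips (v \<otimes> s a) w = flips v (s a \<otimes> w)"
proof -
  have "b \<in> flips (v \<otimes> s a) w \<longleftrightarrow> b \<in> flips v (s a \<otimes> w)" if "b \<in> Pos" for b
  proof (cases "act w b = a")
    case True
    then show ?thesis
      using that a \<Delta>_subset act_v_neg by (auto simp: flips_def act_word_simps act_simple)
  next
    case False
    then show ?thesis
      using that act_simple_iff[OF a, of "act w b"] not_neg_simple[OF that] act_closed w Pos_subset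
      by (auto simp: flips_def act_word_simps)
  qed
  then show ?thesis by (auto simp: flips_def)
qed

text \<open>The two copies of \<open>s a\<close> cancel in the second condition, so the sets can
  differ only where \<open>s a\<close> changes the sign of \<open>act w b\<close>, that is at
  \<open>act w b = a\<close>. On the left this root goes to \<open>neg a\<close> and then to the
  positive root \<open>act v a\<close>, so it is a flip; on the right it goes to \<open>a\<close>
  first and is none.\<close>

lemma flips_cancel:
  "flips (v \<otimes> s a) (s a \<otimes> w) = insert (act (inv w) a) (flips v w)"
  "act (inv w) a \<notin> flips v w"
proof -
  have eq: "act (v \<otimes> s a) (act (s a) (act w b)) = act v (act w b)" if "b \<in> Pos" for b
    using that v w s_simple_closed[OF a] Pos_subset act_closed
    by (simp add: act_mult act_word_simps(3) subset_iff)
  have "b \<in> flips (v \<otimes> s a) (s a \<otimes> w) \<longleftrightarrow> b = act (inv w) a \<or> b \<in> flips v w"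
    if "b \<in> Pos" for b
  proof (cases "act w b = a")
    case True
    then have "neg a \<notin> Pos"
      using a \<Delta>_subset neg_pos_iff Pos_subset by auto
    then show ?thesis
      using True that act_w_eq_iff[OF that] va eq[OF that]
      by (auto simp: flips_def act_word_simps(2) act_simple a)
  next
    case False
    then show ?thesis
      using that act_simple_iff[OF a, of "act w b"] not_neg_simple[OF that] act_closed w Pos_subset
        act_w_eq_iff[OF that]
      by (auto simp: flips_def act_word_simps(2) eq)
  qed
  then show "flips (v \<otimes> s a) (s a \<otimes> w) = insert (act (inv w) a) (flips v w)"
    using wa by (auto simp: flips_def)
  show "act (inv w) a \<notin> flips v w"
    using wa act_w_eq_iff[of "act (inv w) a"] a \<Delta>_subset by (auto simp: flips_def)
qed

end

end

subsection \<open>Regular maps and characters of the multiplicative group\<close>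

lemma polyfun_mono:
  assumes "p \<in> polyfun F" "F \<subseteq> F'"
  shows "p \<in> polyfun F'"
  using assms(1)
proof induction
  case (const c)
  then show ?case using assms(2) by (auto intro: polyfun.const)
qed (rule polyfun.intros; assumption)+

lemma polyfun_in_UNIV: "p \<in> polyfun F \<Longrightarrow> p \<in> polyfun UNIV"
  by (erule polyfun_mono) simp

lemma polyfun_compose:
  assumes "p \<in> polyfun F" "\<And>i. (\<lambda>x. g x i) \<in> polyfun F"
  shows "(\<lambda>x. p (g x)) \<in> polyfun F"
  using assms(1)
proof induction
  case (coord i)
  show ?case by (rule assms(2))
qed (rule polyfun.intros; assumption)+

lemma polyfun_value:
  assumes "p \<in> polyfun F" "\<And>i. x i \<in> F"
    "\<And>a b. a \<in> F \<Longrightarrow> b \<in> F \<Longrightarrow> a + b \<in> F" "\<And>a b. a \<in> F \<Longrightarrow> b \<in> F \<Longrightarrow> a * b \<in> F"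
  shows "p x \<in> F"
  using assms(1) by induction (simp_all add: assms(2-))

lemma regular_map_mono: "regular_map F Z f \<Longrightarrow> F \<subseteq> F' \<Longrightarrow> regular_map F' Z f"
  using polyfun_mono[of _ F F'] unfolding regular_map_def by blast

lemma regular_map_compose:
  assumes "regular_map F Z f" "regular_map F Z' g" "\<And>x. x \<in> Z \<Longrightarrow> f x \<in> Z'"
  shows "regular_map F Z (\<lambda>x. g (f x))"
  unfolding regular_map_def
proof
  fix i
  obtain q where q: "\<And>i. q i \<in> polyfun F" "\<And>i x. x \<in> Z \<Longrightarrow> f x i = q i x"
    using assms(1) unfolding regular_map_def by metis
  obtain p where p: "p \<in> polyfun F" "\<And>x. x \<in> Z' \<Longrightarrow> g x i = p x"
    using assms(2) unfolding regular_map_def by metis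
  have "g (f x) i = p (\<lambda>i. q i x)" if "x \<in> Z" for x
  proof -
    have "f x = (\<lambda>i. q i x)" using q(2)[OF that] by blast
    then show ?thesis using p(2) assms(3)[OF that] by metis
  qed
  moreover have "(\<lambda>x. p (\<lambda>i. q i x)) \<in> polyfun F"
    by (rule polyfun_compose[where g = "\<lambda>x i. q i x"]) (auto intro: p q)
  ultimately show "\<exists>p\<in>polyfun F. \<forall>x\<in>Z. g (f x) i = p x"
    by (intro bexI[of _ "\<lambda>x. p (\<lambda>i. q i x)"] ballI)
qed

lemma zariski_closed_vimage:
  assumes "zariski_closed Y" "zariski_closed Z" "regular_map UNIV Y f"
  shows "zariski_closed {x \<in> Y. f x \<in> Z}"
proof -
  obtain n S where S: "S \<subseteq> polyfun UNIV" "Y = {x \<in> affine_space n. \<forall>p\<in>S. p x = 0}"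
    using assms(1) unfolding zariski_closed_def by blast
  obtain m S' where S': "S' \<subseteq> polyfun UNIV" "Z = {x \<in> affine_space m. \<forall>p\<in>S'. p x = 0}"
    using assms(2) unfolding zariski_closed_def by blast
  obtain q where q: "\<And>i. q i \<in> polyfun UNIV" "\<And>i x. x \<in> Y \<Longrightarrow> f x i = q i x"
    using assms(3) unfolding regular_map_def by metis
  \<comment> \<open>The coordinates \<open>q i\<close> with \<open>i \<ge> m\<close> force
    \<open>f x\<close> into affine \<open>m\<close>-space; the last part pulls back the equations of
    \<open>Z\<close>.\<close>
  define S'' where "S'' = S \<union> q ` {m..} \<union> (\<lambda>p x. p (\<lambda>i. q i x)) ` S'"
  have f: "f x = (\<lambda>i. q i x)" if "x \<in> Y" for x
    using q(2)[OF that] by blast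
  have "(\<lambda>x. p (\<lambda>i. q i x)) \<in> polyfun UNIV" if "p \<in> S'" for p
    using polyfun_compose[where p = p and g = "\<lambda>x i. q i x"] that S'(1) q(1) by blast
  then have "S'' \<subseteq> polyfun UNIV"
    unfolding S''_def using S(1) q(1) by blast
  moreover have "f x \<in> Z \<longleftrightarrow> (\<forall>p\<in>q ` {m..} \<union> (\<lambda>p x. p (\<lambda>i. q i x)) ` S'. p x = 0)" if "x \<in> Y" for x
    by (auto simp: S'(2) f[OF that] affine_space_def)
  then have "{x \<in> Y. f x \<in> Z} = {x \<in> affine_space n. \<forall>p\<in>S''. p x = 0}"
    using S(2) by (auto simp: S''_def ball_Un)
  ultimately show ?thesis
    unfolding zariski_closed_def by blast
qed

text \<open>Fixing one factor of the multiplication polynomials turns the coordinates of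
  \<open>g\<close> into coefficients. As \<open>g\<close> need not be rational, the result is
  regular over the whole field only.\<close>

lemma regular_map_translations:
  assumes "affine_alg_group F G" "g \<in> carrier G"
  shows "regular_map UNIV (carrier G) (\<lambda>x. g \<otimes>\<^bsub>G\<^esub> x)"
    "regular_map UNIV (carrier G) (\<lambda>x. x \<otimes>\<^bsub>G\<^esub> g)"
proof -
  obtain p where p: "\<And>i. p i \<in> polyfun F"
    "\<And>i x y. x \<in> carrier G \<Longrightarrow> y \<in> carrier G \<Longrightarrow> (x \<otimes>\<^bsub>G\<^esub> y) i = p i (interleave x y)"
    using assms(1) unfolding affine_alg_group_def by metis
  have coords: "(\<lambda>x. interleave g x i) \<in> polyfun UNIV" "(\<lambda>x. interleave x g i) \<in> polyfun UNIV" for i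
    by (cases "even i"; simp add: interleave_def polyfun.const polyfun.coord)+
  have "(\<lambda>x. p i (interleave g x)) \<in> polyfun UNIV" "(\<lambda>x. p i (interleave x g)) \<in> polyfun UNIV" for i
    using polyfun_compose[OF polyfun_in_UNIV[OF p(1)], where g = "interleave g"]
      polyfun_compose[OF polyfun_in_UNIV[OF p(1)], where g = "\<lambda>x. interleave x g"] coords by blast+
  then show "regular_map UNIV (carrier G) (\<lambda>x. g \<otimes>\<^bsub>G\<^esub> x)"
    "regular_map UNIV (carrier G) (\<lambda>x. x \<otimes>\<^bsub>G\<^esub> g)"
    unfolding regular_map_def using p(2) assms(2) by (metis (no_types, lifting))+
qed

lemma regular_map_conj:
  assumes "affine_alg_group F G" "g \<in> carrier G" "h \<in> carrier G"
  shows "regular_map UNIV (carrier G) (\<lambda>x. g \<otimes>\<^bsub>G\<^esub> x \<otimes>\<^bsub>G\<^esub> h)"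
proof -
  interpret group G using assms by (simp add: affine_alg_group_def)
  show ?thesis
    using regular_map_compose[OF regular_map_translations(1)[OF assms(1,2)]
        regular_map_translations(2)[OF assms(1,3)]] assms(2) by blast
qed

section \<open>Invertible regular functions on the multiplicative group\<close>

lemma infinite_UNIV_alg_closed: "infinite (UNIV :: 'l::alg_closed_field set)"
proof
  assume fin: "finite (UNIV :: 'l set)"
  \<comment> \<open>The product of all \<open>X - a\<close> vanishes everywhere; adding one gives a
    polynomial of positive degree without roots.\<close>
  define p :: "'l poly" where "p = (\<Prod>a\<in>UNIV. [:- a, 1:])"
  have p: "degree p = card (UNIV :: 'l set)"
    unfolding p_def by (subst degree_prod_eq_sum_degree) auto
  moreover have "card (UNIV :: 'l set) > 0"
    using fin by (simp add: card_gt_0_iff)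
  ultimately have "degree (p + 1) > 0"
    by (subst degree_add_eq_left) auto
  then obtain x where "poly (p + 1) x = 0"
    using alg_closed_imp_poly_has_root by blast
  moreover have "poly p x = 0"
    unfolding p_def poly_prod using fin by (auto simp: prod_zero_iff)
  ultimately show False by simp
qed

text \<open>If the exponents differed by \<open>m > 0\<close>, every nonzero element would be a root
  of \<open>X^m - 1\<close>. This makes the exponent in \<open>pairing\<close> unique.\<close>

lemma powi_eq_imp_eq:
  fixes j k :: int
  assumes "\<And>x :: 'l::alg_closed_field. x \<noteq> 0 \<Longrightarrow> x powi j = x powi k"
  shows "j = k"
proof -
  have *: "j \<le> k" if "\<And>x :: 'l. x \<noteq> 0 \<Longrightarrow> x powi j = x powi k" for j k :: int
  proof (rule ccontr)
    assume "\<not> j \<le> k"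
    define m where "m = nat (j - k)"
    have m: "m > 0" "int m = j - k" using \<open>\<not> j \<le> k\<close> by (auto simp: m_def)
    have "x ^ m = 1" if x: "x \<noteq> 0" for x :: 'l
    proof -
      have "x powi (j - k) = 1"
        using that \<open>\<And>x. x \<noteq> 0 \<Longrightarrow> x powi j = x powi k\<close>[OF x] by (simp add: power_int_diff)
      then show ?thesis using m(2) by (metis power_int_of_nat)
    qed
    then have "UNIV \<subseteq> insert 0 {x :: 'l. poly (monom 1 m - 1) x = 0}"
      by (auto simp: poly_monom)
    moreover have "monom 1 m - 1 \<noteq> (0 :: 'l poly)"
    proof
      assume "monom 1 m - 1 = (0 :: 'l poly)"
      then have "coeff (monom 1 m :: 'l poly) m = coeff 1 m" by simp
      then show False using m by simp
    qed
    ultimately show False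
      using poly_roots_finite infinite_UNIV_alg_closed by (metis finite_insert finite_subset)
  qed
  show ?thesis using *[of j k] *[of k j] assms by (simp add: order_antisym)
qed

text \<open>Polynomial functions on the multiplicative group are Laurent polynomials; the factor
  \<open>x ^ n\<close> clears the denominators coming from the coordinate
  \<open>1/x\<close>.\<close>

lemma polyfun_gm_point:
  assumes "p \<in> polyfun UNIV"
  shows "\<exists>n P. \<forall>x. x \<noteq> 0 \<longrightarrow> p (gm_point x) * x ^ n = poly P x"
  using assms
proof induction
  case (const c)
  show ?case by (intro exI[of _ 0] exI[of _ "[:c:]"]) simp
next
  case (coord i)
  consider "i = 0" | "i = 1" | "i \<noteq> 0" "i \<noteq> 1" by blast
  then show ?case
  proof cases
    case 1
    then show ?thesis by (intro exI[of _ 0] exI[of _ "[:0, 1:]"]) (simp add: gm_point_def)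
  next
    case 2
    then show ?thesis by (intro exI[of _ 1] exI[of _ 1]) (simp add: gm_point_def)
  next
    case 3
    then show ?thesis by (intro exI[of _ 0] exI[of _ 0]) (simp add: gm_point_def)
  qed
next
  case (add p q)
  then obtain m P n Q where PQ:
    "\<And>x. x \<noteq> 0 \<Longrightarrow> p (gm_point x) * x ^ m = poly P x" "\<And>x. x \<noteq> 0 \<Longrightarrow> q (gm_point x) * x ^ n = poly Q x"
    by blast
  show ?case
    by (intro exI[of _ "m + n"] exI[of _ "P * monom 1 n + Q * monom 1 m"])
      (auto simp: poly_monom power_add PQ[symmetric] algebra_simps)
next
  case (mult p q)
  then obtain m P n Q where PQ:
    "\<And>x. x \<noteq> 0 \<Longrightarrow> p (gm_point x) * x ^ m = poly P x" "\<And>x. x \<noteq> 0 \<Longrightarrow> q (gm_point x) * x ^ n = poly Q x"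
    by blast
  show ?case
    by (intro exI[of _ "m + n"] exI[of _ "P * Q"]) (auto simp: power_add PQ[symmetric] algebra_simps)
qed

text \<open>After clearing denominators, the factor of \<open>P\<close> prime to \<open>X\<close>
  has no root: not at \<open>0\<close> by construction, and not elsewhere because \<phi> does not
  vanish. Hence it is a constant, and the value at \<open>1\<close> makes it
  \<open>1\<close>.\<close>

lemma Gm_unit_power:
  fixes \<phi> :: "'l::alg_closed_field \<Rightarrow> 'l"
  assumes "p \<in> polyfun UNIV" "\<And>x. x \<noteq> 0 \<Longrightarrow> \<phi> x = p (gm_point x)"
    "\<And>x. x \<noteq> 0 \<Longrightarrow> \<phi> x \<noteq> 0" "\<phi> 1 = 1"
  shows "\<exists>k::int. \<forall>x. x \<noteq> 0 \<longrightarrow> \<phi> x = x powi k"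
proof -
  obtain n P where P: "\<And>x. x \<noteq> 0 \<Longrightarrow> \<phi> x * x ^ n = poly P x"
    using polyfun_gm_point[OF assms(1)] assms(2) by metis
  have "poly P 1 \<noteq> 0" using P[of 1] assms(4) by simp
  then have "P \<noteq> 0" by auto
  then obtain Q where Q: "P = [:0, 1:] ^ order 0 P * Q" "\<not> [:0, 1:] dvd Q"
    using order_decomp[of P 0] by auto
  have "poly Q x \<noteq> 0" for x
  proof (cases "x = 0")
    case True
    then show ?thesis using Q(2) by (simp add: dvd_iff_poly_eq_0)
  next
    case False
    then have "poly P x \<noteq> 0" using P[of x] assms(3) by (metis mult_eq_0_iff power_not_zero)
    then show ?thesis by (subst (asm) Q(1)) auto
  qed
  then have "degree Q = 0"
    using alg_closed_imp_poly_has_root by blast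
  then obtain c where c: "Q = [:c:]" by (rule degree_eq_zeroE)
  have eq: "\<phi> x * x ^ n = x ^ order 0 P * c" if "x \<noteq> 0" for x
    using P[OF that] by (subst (asm) Q(1)) (simp add: c poly_power)
  have "c = 1" using eq[of 1] assms(4) by simp
  then have "\<phi> x = x powi (int (order 0 P) - int n)" if "x \<noteq> 0" for x
    using eq[OF that] that by (simp add: power_int_diff field_simps)
  then show ?thesis by blast
qed

subsection \<open>The normalizer of the torus and the Weyl group\<close>

context group
begin

definition conjugate :: "'a \<Rightarrow> 'a \<Rightarrow> 'a" where
  "conjugate g x = g \<otimes> x \<otimes> inv g"

lemma inv_cancel:
  "x \<in> carrier G \<Longrightarrow> y \<in> carrier G \<Longrightarrow> inv x \<otimes> (x \<otimes> y) = y"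
  "x \<in> carrier G \<Longrightarrow> y \<in> carrier G \<Longrightarrow> x \<otimes> (inv x \<otimes> y) = y"
  by (simp_all add: m_assoc[symmetric])

lemma conjugate_closed [simp]: "g \<in> carrier G \<Longrightarrow> x \<in> carrier G \<Longrightarrow> conjugate g x \<in> carrier G"
  by (simp add: conjugate_def)

lemma conjugate_mult:
  "g \<in> carrier G \<Longrightarrow> x \<in> carrier G \<Longrightarrow> y \<in> carrier G \<Longrightarrow> conjugate g (x \<otimes> y) = conjugate g x \<otimes> conjugate g y"
  by (simp add: conjugate_def m_assoc inv_cancel)

lemma conjugate_comp:
  "g \<in> carrier G \<Longrightarrow> h \<in> carrier G \<Longrightarrow> x \<in> carrier G \<Longrightarrow> conjugate (g \<otimes> h) x = conjugate g (conjugate h x)"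
  by (simp add: conjugate_def m_assoc inv_mult_group)

lemma conjugate_inv:
  "g \<in> carrier G \<Longrightarrow> x \<in> carrier G \<Longrightarrow> conjugate g (inv x) = inv (conjugate g x)"
  by (simp add: conjugate_def m_assoc inv_mult_group)

lemma conjugate_one_left [simp]: "x \<in> carrier G \<Longrightarrow> conjugate \<one> x = x"
  by (simp add: conjugate_def)

lemma conjugate_one [simp]: "g \<in> carrier G \<Longrightarrow> conjugate g \<one> = \<one>"
  by (simp add: conjugate_def)

lemma conjugate_conjugate_inv [simp]:
  "g \<in> carrier G \<Longrightarrow> x \<in> carrier G \<Longrightarrow> conjugate g (conjugate (inv g) x) = x"
  "g \<in> carrier G \<Longrightarrow> x \<in> carrier G \<Longrightarrow> conjugate (inv g) (conjugate g x) = x"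
  by (simp_all add: conjugate_comp[symmetric])

lemma conjugate_eq_mult: "g \<in> carrier G \<Longrightarrow> x \<in> carrier G \<Longrightarrow> conjugate g x \<otimes> g = g \<otimes> x"
  by (simp add: conjugate_def m_assoc)

lemma conjugate_eq_self_iff:
  "g \<in> carrier G \<Longrightarrow> x \<in> carrier G \<Longrightarrow> conjugate g x = x \<longleftrightarrow> g \<otimes> x = x \<otimes> g"
  by (metis conjugate_closed conjugate_eq_mult r_cancel)

end

section \<open>The torus and the rational points\<close>

locale split_torus_group = group G for G :: "'l::alg_closed_field point monoid" (structure) +
  fixes K :: "'l set" and T :: "'l point set"
  assumes K_add: "\<And>x y. x \<in> K \<Longrightarrow> y \<in> K \<Longrightarrow> x + y \<in> K"
    and K_mult: "\<And>x y. x \<in> K \<Longrightarrow> y \<in> K \<Longrightarrow> x * y \<in> K"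
    and alg: "affine_alg_group K G"
    and torus: "split_torus K G T"
begin

lemma T_subgroup: "subgroup T G"
  using torus by (simp add: split_torus_def closed_subgroup_def)

lemma T_closed: "t \<in> T \<Longrightarrow> t \<in> carrier G"
  using subgroup.subset[OF T_subgroup] by blast

lemmas T_mult = subgroup.m_closed[OF T_subgroup]
lemmas T_one = subgroup.one_closed[OF T_subgroup]
lemmas T_inv = subgroup.m_inv_closed[OF T_subgroup]

text \<open>Commutativity is transported from \<open>Gm_pow r\<close>, where multiplication is
  coordinatewise.\<close>

lemma T_comm:
  assumes "x \<in> T" "y \<in> T"
  shows "x \<otimes> y = y \<otimes> x"
proof -
  obtain r f where iso: "alg_iso K (Gm_pow r) (G\<lparr>carrier := T\<rparr>) f"
    using torus by (auto simp: split_torus_def)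
  then have f: "f \<in> hom (Gm_pow r) (G\<lparr>carrier := T\<rparr>)"
    by (simp add: alg_iso_def alg_hom_def)
  obtain g where g: "g \<in> hom (G\<lparr>carrier := T\<rparr>) (Gm_pow r)" and fg: "\<And>y. y \<in> T \<Longrightarrow> f (g y) = y"
    using iso by (auto simp: alg_iso_def alg_hom_def)
  have *: "g x \<in> carrier (Gm_pow r)" "g y \<in> carrier (Gm_pow r)"
    using g assms by (auto simp: hom_def)
  have "x \<otimes> y = f (g x) \<otimes> f (g y)"
    using fg assms by simp
  also have "\<dots> = f (g x \<otimes>\<^bsub>Gm_pow r\<^esub> g y)"
    using f * by (auto simp: hom_def)
  also have "g x \<otimes>\<^bsub>Gm_pow r\<^esub> g y = g y \<otimes>\<^bsub>Gm_pow r\<^esub> g x"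
    by (simp add: Gm_pow_def mult.commute)
  also have "f \<dots> = f (g y) \<otimes> f (g x)"
    using f * by (auto simp: hom_def)
  finally show ?thesis
    using fg assms by simp
qed

lemma T_conj: "x \<in> T \<Longrightarrow> y \<in> T \<Longrightarrow> conjugate x y = y"
  using T_comm T_closed by (simp add: conjugate_eq_self_iff)

lemma T_comm_group: "comm_group (G\<lparr>carrier := T\<rparr>)"
  by (rule group.group_comm_groupI[OF subgroup.subgroup_is_group[OF T_subgroup group_axioms]])
    (simp add: T_comm)

lemma rational_subgroup: "subgroup (rational_points K (carrier G)) G"
proof (rule subgroupI)
  show "rational_points K (carrier G) \<noteq> {}"
    using alg unfolding affine_alg_group_def by blast
next
  fix x assume x: "x \<in> rational_points K (carrier G)"
  have "(inv x) i \<in> K" for i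
  proof -
    obtain p where "p \<in> polyfun K" "\<forall>x\<in>carrier G. (inv x) i = p x"
      using alg unfolding affine_alg_group_def regular_map_def by blast
    then show ?thesis
      using x polyfun_value[of p K x] K_add K_mult by (simp add: rational_points_def)
  qed
  then show "inv x \<in> rational_points K (carrier G)"
    using x by (simp add: rational_points_def)
next
  fix x y assume xy: "x \<in> rational_points K (carrier G)" "y \<in> rational_points K (carrier G)"
  have "(x \<otimes> y) i \<in> K" for i
  proof -
    obtain p where p: "p \<in> polyfun K" "\<forall>x\<in>carrier G. \<forall>y\<in>carrier G. (x \<otimes> y) i = p (interleave x y)"
      using alg unfolding affine_alg_group_def by blast
    have "interleave x y i \<in> K" for i
      using xy by (simp add: interleave_def rational_points_def)
    then show ?thesis
      using xy p polyfun_value[of p K "interleave x y"] K_add K_mult by (simp add: rational_points_def)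
  qed
  then show "x \<otimes> y \<in> rational_points K (carrier G)"
    using xy by (simp add: rational_points_def)
qed (auto simp: rational_points_def)

text \<open>The normalizer over the algebraically closed field, of which \<open>normK\<close> is the
  rational part. The larger group is required because conjugations by arbitrary elements of
  \<open>T\<close> and by \<open>triple b x\<close> with arbitrary nonzero \<open>x\<close>
  occur.\<close>

definition normT :: "'l point set" where
  "normT = {g \<in> carrier G. conjugate g ` T = T}"

abbreviation normK :: "'l point set" where
  "normK \<equiv> normalizer_points K G T"

abbreviation TK :: "'l point set" where
  "TK \<equiv> rational_points K T"

lemma normT_closed: "g \<in> normT \<Longrightarrow> g \<in> carrier G"
  by (simp add: normT_def)

lemma normT_iff:
  "g \<in> normT \<longleftrightarrow> g \<in> carrier G \<and> (\<forall>t\<in>T. conjugate g t \<in> T) \<and> (\<forall>t\<in>T. conjugate (inv g) t \<in> T)"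
proof (cases "g \<in> carrier G")
  case True
  have "conjugate g ` T = T \<longleftrightarrow> (\<forall>t\<in>T. conjugate g t \<in> T) \<and> (\<forall>t\<in>T. conjugate (inv g) t \<in> T)"
  proof
    assume *: "conjugate g ` T = T"
    have "conjugate (inv g) t \<in> T" if "t \<in> T" for t
    proof -
      have "t \<in> conjugate g ` T" using * that by simp
      then obtain t' where "t' \<in> T" "t = conjugate g t'" by (rule imageE) simp
      then show ?thesis using True T_closed by simp
    qed
    moreover have "conjugate g t \<in> T" if "t \<in> T" for t
      using imageI[OF that, of "conjugate g"] * by simp
    ultimately show "(\<forall>t\<in>T. conjugate g t \<in> T) \<and> (\<forall>t\<in>T. conjugate (inv g) t \<in> T)"
      by simp
  next
    assume *: "(\<forall>t\<in>T. conjugate g t \<in> T) \<and> (\<forall>t\<in>T. conjugate (inv g) t \<in> T)"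
    have "t \<in> conjugate g ` T" if "t \<in> T" for t
      using * that True T_closed by (intro image_eqI[of _ _ "conjugate (inv g) t"]) auto
    then show "conjugate g ` T = T" using * by blast
  qed
  then show ?thesis using True by (simp add: normT_def)
qed (simp add: normT_def)

lemma normT_conj:
  "g \<in> normT \<Longrightarrow> t \<in> T \<Longrightarrow> conjugate g t \<in> T" "g \<in> normT \<Longrightarrow> t \<in> T \<Longrightarrow> conjugate (inv g) t \<in> T"
  by (auto simp: normT_iff)

lemma normT_subgroup: "subgroup normT G"
proof (rule subgroupI)
  have "\<one> \<in> normT" by (simp add: normT_iff T_closed)
  then show "normT \<noteq> {}" by blast
  show "inv g \<in> normT" if "g \<in> normT" for g
    using that by (simp add: normT_iff)
  show "g \<otimes> h \<in> normT" if "g \<in> normT" "h \<in> normT" for g h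
    using that T_closed unfolding normT_iff by (simp add: conjugate_comp inv_mult_group)
qed (auto simp: normT_def)

lemma T_subset_normT: "T \<subseteq> normT"
  using T_conj T_inv T_closed by (auto simp: normT_iff)

lemma normK_eq: "normK = rational_points K (carrier G) \<inter> normT"
  by (auto simp: normalizer_points_def normT_def conjugate_def rational_points_def)

lemma normK_subgroup: "subgroup normK G"
  unfolding normK_eq by (intro subgroups_Inter_pair rational_subgroup normT_subgroup)

lemma normK_normT: "g \<in> normK \<Longrightarrow> g \<in> normT"
  by (simp add: normK_eq)

lemma normK_closed: "g \<in> normK \<Longrightarrow> g \<in> carrier G"
  by (simp add: normK_normT normT_closed)

lemmas normK_mult = subgroup.m_closed[OF normK_subgroup]
lemmas normK_one = subgroup.one_closed[OF normK_subgroup]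
lemmas normK_inv = subgroup.m_inv_closed[OF normK_subgroup]
lemmas normT_mult = subgroup.m_closed[OF normT_subgroup]
lemmas normT_inv = subgroup.m_inv_closed[OF normT_subgroup]

lemma TK_eq: "TK = normK \<inter> T"
  using T_subset_normT normT_closed by (auto simp: normK_eq rational_points_def)

lemma TK_subset: "TK \<subseteq> normK" "TK \<subseteq> T"
  by (auto simp: TK_eq)

lemma TK_normal: "TK \<lhd> G\<lparr>carrier := normK\<rparr>"
proof -
  interpret N: group "G\<lparr>carrier := normK\<rparr>"
    by (rule subgroup.subgroup_is_group[OF normK_subgroup group_axioms])
  have "subgroup TK G"
    unfolding TK_eq by (intro subgroups_Inter_pair normK_subgroup T_subgroup)
  then have "subgroup TK (G\<lparr>carrier := normK\<rparr>)"
    using TK_subset(1) normK_subgroup by (simp add: subgroup_incl)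
  moreover have "x \<otimes> h \<otimes> inv x \<in> TK" if "x \<in> normK" "h \<in> TK" for x h
  proof -
    have "conjugate x h \<in> T" using that TK_subset(2) normT_conj(1) normK_normT by blast
    moreover have "conjugate x h \<in> normK"
      unfolding conjugate_def using that TK_subset(1) by (blast intro: normK_mult normK_inv)
    ultimately show ?thesis by (simp add: TK_eq conjugate_def)
  qed
  ultimately show ?thesis
    using m_inv_consistent[OF normK_subgroup] by (simp add: N.normal_inv_iff)
qed

section \<open>The Weyl group as cosets of the rational torus points\<close>

abbreviation W :: "'l point set monoid" where
  "W \<equiv> weyl_group K G T"

lemma W_group: "group W"
  unfolding weyl_group_def by (rule normal.factorgroup_is_group[OF TK_normal])

definition cls :: "'l point \<Rightarrow> 'l point set" where
  "cls n = TK #> n"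

lemma cls_eq: "cls n = TK #>\<^bsub>G\<lparr>carrier := normK\<rparr>\<^esub> n"
  by (simp add: cls_def r_coset_def)

lemma W_carrier: "carrier W = cls ` normK"
  unfolding weyl_group_def FactGroup_def by (auto simp: RCOSETS_def cls_eq)

lemma cls_W: "n \<in> normK \<Longrightarrow> cls n \<in> carrier W"
  by (simp add: W_carrier)

lemma cls_mult: "m \<in> normK \<Longrightarrow> n \<in> normK \<Longrightarrow> cls m \<otimes>\<^bsub>W\<^esub> cls n = cls (m \<otimes> n)"
  unfolding weyl_group_def FactGroup_def cls_eq using normal.rcos_sum[OF TK_normal, of m n] by simp

lemma cls_TK: "t \<in> TK \<Longrightarrow> cls t = TK"
  unfolding cls_eq
  by (rule subgroup.rcos_const[OF normal_imp_subgroup[OF TK_normal]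
        subgroup.subgroup_is_group[OF normK_subgroup group_axioms]])

lemma TK_one: "\<one> \<in> TK"
  using normK_one T_one by (simp add: TK_eq)

lemma cls_one: "\<one>\<^bsub>W\<^esub> = cls \<one>"
  by (simp add: cls_TK TK_one weyl_group_def FactGroup_def)

lemma mem_cls_iff: "n \<in> cls m \<longleftrightarrow> (\<exists>t\<in>TK. n = t \<otimes> m)"
  by (auto simp: cls_def r_coset_def)

lemma cls_self: "m \<in> normK \<Longrightarrow> m \<in> cls m"
  using TK_one normK_closed by (auto simp: mem_cls_iff intro!: bexI[of _ \<one>])

lemma cls_TK_mult:
  assumes "t \<in> TK" "m \<in> normK"
  shows "cls (t \<otimes> m) = cls m"
proof -
  have t: "t \<in> normK" "t \<in> T" using assms by (auto simp: TK_eq)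
  have "cls t = cls \<one>"
    using assms(1) by (simp add: cls_TK TK_one)
  then show ?thesis
    using cls_mult[OF t(1) assms(2)] cls_mult[OF normK_one assms(2)] normK_closed[OF assms(2)] by simp
qed

lemma mem_W:
  assumes "w \<in> carrier W" "n \<in> w"
  shows "n \<in> normK" "w = cls n"
proof -
  obtain m where m: "m \<in> normK" "w = cls m" using assms(1) W_carrier by auto
  then obtain t where t: "t \<in> TK" "n = t \<otimes> m" using assms(2) mem_cls_iff by auto
  show "n \<in> normK" using t m(1) TK_subset(1) normK_mult by blast
  show "w = cls n" using t m cls_TK_mult by simp
qed

lemma cls_inv: "n \<in> normK \<Longrightarrow> inv\<^bsub>W\<^esub> (cls n) = cls (inv n)"
  using group.inv_equality[OF W_group, of "cls (inv n)" "cls n"] normK_inv normK_closed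
  by (simp add: cls_mult cls_W cls_one)

text \<open>The action of a named representative, whereas \<open>weyl_act\<close> picks one by
  \<open>SOME\<close>. It is meaningful on all of \<open>normT\<close>, not only for rational
  elements.\<close>

definition cact :: "'l point \<Rightarrow> 'l chr \<Rightarrow> 'l chr" where
  "cact n a = (\<lambda>t\<in>T. a (conjugate (inv n) t))"

lemma cact_conj: "n \<in> normT \<Longrightarrow> t \<in> T \<Longrightarrow> cact n a (conjugate n t) = a t"
  using normT_conj(1) normT_closed T_closed by (simp add: cact_def)

lemma cact_mult:
  "m \<in> normT \<Longrightarrow> n \<in> normT \<Longrightarrow> cact (m \<otimes> n) a = cact m (cact n a)"
  using normT_conj normT_closed T_closed
  by (auto simp: cact_def inv_mult_group conjugate_comp)

lemma cact_one: "a \<in> extensional T \<Longrightarrow> cact \<one> a = a"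
  using T_closed by (auto simp: cact_def fun_eq_iff extensional_def)

text \<open>Conjugation by \<open>t\<close> is trivial on the commutative group \<open>T\<close>.
  The right side is not simply \<open>a\<close>, since \<open>cact\<close> restricts its result to
  \<open>T\<close> and \<open>a\<close> may be arbitrary outside.\<close>

lemma cact_T: "t \<in> T \<Longrightarrow> cact t a = cact \<one> a"
  using T_closed T_conj T_inv by (auto simp: cact_def)

lemma cact_neg: "n \<in> normT \<Longrightarrow> cact n (chr_neg T a) = chr_neg T (cact n a)"
  using normT_conj by (auto simp: cact_def chr_neg_def)

text \<open>The representative picked by \<open>SOME\<close> differs from \<open>n\<close> by a
  factor in \<open>T\<close>, which acts trivially.\<close>

lemma weyl_act_cls:
  assumes n: "n \<in> normK"
  shows "weyl_act G T (cls n) a = cact n a"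
proof -
  have "(SOME m. m \<in> cls n) \<in> cls n"
    using cls_self[OF n] by (rule someI[of "\<lambda>m. m \<in> cls n"])
  then obtain t where t: "t \<in> TK" "(SOME m. m \<in> cls n) = t \<otimes> n"
    by (auto simp: mem_cls_iff)
  then have tT: "t \<in> T" using TK_subset by blast
  have "weyl_act G T (cls n) a = cact (t \<otimes> n) a"
    using t(2) n tT T_closed normK_closed by (simp add: weyl_act_def cact_def conjugate_def Let_def)
  also have "\<dots> = cact \<one> (cact n a)"
    using tT T_subset_normT normK_normT[OF n] cact_T by (subst cact_mult) auto
  also have "\<dots> = cact n a"
    by (rule cact_one) (simp add: cact_def)
  finally show ?thesis .
qed

section \<open>Characters, cocharacters and their pairing\<close>

lemma characterD:
  assumes "a \<in> characters G T"
  shows "a \<in> extensional T" "\<And>x y. x \<in> T \<Longrightarrow> y \<in> T \<Longrightarrow> a (x \<otimes> y) = a x * a y"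
    "\<And>x. x \<in> T \<Longrightarrow> a x \<noteq> 0" "regular_map UNIV T (\<lambda>t. gm_point (a t))"
proof -
  have ext: "a \<in> extensional T"
    and hom: "(\<lambda>t. gm_point (a t)) \<in> hom (G\<lparr>carrier := T\<rparr>) (Gm_pow 1)"
    and reg: "regular_map UNIV T (\<lambda>t. gm_point (a t))"
    using assms by (auto simp: characters_def alg_hom_def)
  show "a \<in> extensional T" "regular_map UNIV T (\<lambda>t. gm_point (a t))" by fact+
  show "a (x \<otimes> y) = a x * a y" if "x \<in> T" "y \<in> T" for x y
  proof -
    have "gm_point (a (x \<otimes> y)) = gm_point (a x) \<otimes>\<^bsub>Gm_pow 1\<^esub> gm_point (a y)"
      using hom that by (auto simp: hom_def)
    from fun_cong[OF this, of 0] show ?thesis by (simp add: gm_point_def Gm_pow_def)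
  qed
  show "a x \<noteq> 0" if "x \<in> T" for x
  proof -
    have "gm_point (a x) \<in> carrier (Gm_pow 1)"
      using hom that by (auto simp: hom_def)
    then show ?thesis by (auto simp: Gm_pow_def gm_point_def)
  qed
qed

lemma character_one: "a \<in> characters G T \<Longrightarrow> a \<one> = 1"
  using characterD(2)[of a \<one> \<one>] characterD(3)[of a \<one>] T_one by simp

lemma character_inv:
  assumes "a \<in> characters G T" "x \<in> T"
  shows "a (inv x) = inverse (a x)"
proof -
  have "a x * a (inv x) = 1"
    using characterD(2)[OF assms(1,2) T_inv[OF assms(2)]] character_one[OF assms(1)] T_closed[OF assms(2)]
    by simp
  then show ?thesis by (metis inverse_unique)
qed

lemma cocharacterD:
  assumes "l \<in> cocharacters G T"
  shows "\<And>x. x \<noteq> 0 \<Longrightarrow> l x \<in> T" "\<And>x y. x \<noteq> 0 \<Longrightarrow> y \<noteq> 0 \<Longrightarrow> l (x * y) = l x \<otimes> l y"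
    "regular_map UNIV (carrier (Gm_pow 1)) (\<lambda>z. l (z 0))"
proof -
  have hom: "(\<lambda>z. l (z 0)) \<in> hom (Gm_pow 1) (G\<lparr>carrier := T\<rparr>)"
    and reg: "regular_map UNIV (carrier (Gm_pow 1)) (\<lambda>z. l (z 0))"
    using assms by (auto simp: cocharacters_def alg_hom_def)
  have gm: "gm_point x \<in> carrier (Gm_pow 1)" if "x \<noteq> 0" for x :: 'l
    using that by (auto simp: Gm_pow_def gm_point_def affine_space_def)
  show "regular_map UNIV (carrier (Gm_pow 1)) (\<lambda>z. l (z 0))" by (fact reg)
  show "l x \<in> T" if "x \<noteq> 0" for x
    using hom gm[OF that] by (auto simp: hom_def gm_point_def dest: funcset_mem)
  show "l (x * y) = l x \<otimes> l y" if "x \<noteq> 0" "y \<noteq> 0" for x y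
  proof -
    have "l ((gm_point x \<otimes>\<^bsub>Gm_pow 1\<^esub> gm_point y) 0) = l (gm_point x 0) \<otimes> l (gm_point y 0)"
      using hom gm[OF that(1)] gm[OF that(2)] by (auto simp: hom_def)
    then show ?thesis by (simp add: Gm_pow_def gm_point_def)
  qed
qed

lemma cocharacter_one: "l \<in> cocharacters G T \<Longrightarrow> l 1 = \<one>"
  using cocharacterD(2)[of l 1 1] cocharacterD(1)[of l 1] T_closed by (simp add: l_cancel_one)

text \<open>Justifies the definite description in \<open>pairing\<close>: the composite is a nowhere
  vanishing regular function on the multiplicative group, so \<open>Gm_unit_power\<close> gives an
  exponent, and \<open>powi_eq_imp_eq\<close> makes it unique.\<close>

lemma character_cocharacter:
  assumes a: "a \<in> characters G T" and l: "l \<in> cocharacters G T" and x: "x \<noteq> 0"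
  shows "a (l x) = x powi pairing a l"
proof -
  have gm: "gm_point x \<in> carrier (Gm_pow 1)" if "x \<noteq> 0" for x :: 'l
    using that by (auto simp: Gm_pow_def gm_point_def affine_space_def)
  have "regular_map UNIV (carrier (Gm_pow 1)) (\<lambda>z. gm_point (a (l (z 0))))"
  proof (rule regular_map_compose[OF cocharacterD(3)[OF l] characterD(4)[OF a]])
    fix z :: "'l point" assume "z \<in> carrier (Gm_pow 1)"
    then have "z 0 \<noteq> 0" by (auto simp: Gm_pow_def)
    then show "l (z 0) \<in> T" using cocharacterD(1)[OF l] by simp
  qed
  then obtain p where p: "p \<in> polyfun UNIV" "\<And>z. z \<in> carrier (Gm_pow 1) \<Longrightarrow> gm_point (a (l (z 0))) 0 = p z"
    unfolding regular_map_def by blast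
  have "\<exists>k::int. \<forall>x. x \<noteq> 0 \<longrightarrow> a (l x) = x powi k"
  proof (rule Gm_unit_power[OF p(1)])
    show "a (l x) = p (gm_point x)" if "x \<noteq> 0" for x
      using p(2)[OF gm[OF that]] by (simp add: gm_point_def)
    show "a (l x) \<noteq> 0" if "x \<noteq> 0" for x
      using characterD(3)[OF a] cocharacterD(1)[OF l] that by simp
    show "a (l 1) = 1"
      using a l by (simp add: cocharacter_one character_one)
  qed
  then obtain k :: int where k: "\<forall>x. x \<noteq> 0 \<longrightarrow> a (l x) = x powi k" by blast
  have "pairing a l = k"
    unfolding pairing_def
  proof (rule the_equality)
    show "\<forall>x. x \<noteq> 0 \<longrightarrow> a (l x) = x powi k" by (fact k)
    fix j :: int assume "\<forall>x. x \<noteq> 0 \<longrightarrow> a (l x) = x powi j"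
    then show "j = k" using k powi_eq_imp_eq[where 'l = 'l, of j k] by simp
  qed
  then show ?thesis using k x by simp
qed

end

subsection \<open>Conjugates of root subgroups\<close>

lemma regular_map_subset: "regular_map F Z f \<Longrightarrow> Y \<subseteq> Z \<Longrightarrow> regular_map F Y f"
  unfolding regular_map_def by (meson subsetD)

lemma chr_neg_apply: "t \<in> T \<Longrightarrow> chr_neg T a t = inverse (a t)"
  by (simp add: chr_neg_def)

lemma chr_neg_neg: "a \<in> extensional T \<Longrightarrow> chr_neg T (chr_neg T a) = a"
  by (auto simp: chr_neg_def extensional_def fun_eq_iff)

locale realized_group = split_torus_group G K T
  for G :: "'l::alg_closed_field point monoid" (structure) and K T +
  fixes cr :: "'l chr \<Rightarrow> 'l cochr" and s :: "'l chr \<Rightarrow> 'l point set" and u :: "'l chr \<Rightarrow> 'l \<Rightarrow> 'l point"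
  assumes root_datum: "reduced_root_datum G T cr"
    and reflections: "\<And>a. a \<in> roots G T \<Longrightarrow> is_weyl_reflection K G T cr a (s a)"
    and realized: "realization K G T cr s u"
begin

abbreviation \<Phi> :: "'l chr set" where
  "\<Phi> \<equiv> roots G T"

abbreviation neg :: "'l chr \<Rightarrow> 'l chr" where
  "neg \<equiv> chr_neg T"

abbreviation triple :: "'l chr \<Rightarrow> 'l \<Rightarrow> 'l point" where
  "triple \<equiv> root_triple G T u"

abbreviation rep :: "'l chr \<Rightarrow> 'l point" where
  "rep \<equiv> root_rep G T u"

lemma root_character: "a \<in> \<Phi> \<Longrightarrow> a \<in> characters G T"
  by (simp add: roots_def)

lemma root_ext: "a \<in> \<Phi> \<Longrightarrow> a \<in> extensional T"
  by (rule characterD(1)[OF root_character])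

lemma neg_neg_root: "a \<in> \<Phi> \<Longrightarrow> neg (neg a) = a"
  by (simp add: chr_neg_neg root_ext)

lemma coroot: "a \<in> \<Phi> \<Longrightarrow> cr a \<in> cocharacters G T"
  using root_datum by (auto simp: reduced_root_datum_def)

lemma reflection_root: "a \<in> \<Phi> \<Longrightarrow> b \<in> \<Phi> \<Longrightarrow> chr_reflection T a (cr a) b \<in> \<Phi>"
  using root_datum unfolding reduced_root_datum_def by (metis imageI)

lemma reflection_self: "a \<in> \<Phi> \<Longrightarrow> chr_reflection T a (cr a) a = neg a"
proof -
  assume a: "a \<in> \<Phi>"
  then have "pairing a (cr a) = 2"
    using root_datum by (simp add: reduced_root_datum_def)
  then show ?thesis
    using characterD(3)[OF root_character[OF a]]
    by (auto simp: chr_reflection_def chr_neg_def fun_eq_iff power_int_minus power2_eq_square)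
qed

lemma neg_root: "a \<in> \<Phi> \<Longrightarrow> neg a \<in> \<Phi>"
  using reflection_root[of a a] reflection_self by simp

lemma rep_normK: "a \<in> \<Phi> \<Longrightarrow> rep a \<in> normK"
  using realized unfolding realization_def by blast

lemmas rep_normT = normK_normT[OF rep_normK]
lemmas rep_closed = normK_closed[OF rep_normK]

lemma s_cls: "a \<in> \<Phi> \<Longrightarrow> s a = cls (rep a)"
  using realized reflections mem_W(2) unfolding realization_def is_weyl_reflection_def by blast

lemma triple_eq: "a \<in> \<Phi> \<Longrightarrow> x \<noteq> 0 \<Longrightarrow> triple a x = cr a x \<otimes> rep a"
  using realized unfolding realization_def by blast

lemma cact_rep: "a \<in> \<Phi> \<Longrightarrow> b \<in> characters G T \<Longrightarrow> cact (rep a) b = chr_reflection T a (cr a) b"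
  using reflections s_cls weyl_act_cls rep_normK by (metis is_weyl_reflection_def)

lemma cact_rep_self: "a \<in> \<Phi> \<Longrightarrow> cact (rep a) a = neg a"
  by (simp add: cact_rep root_character reflection_self)

text \<open>Since the pairing of \<open>a\<close> with its coroot is \<open>2\<close>, the coroot at
  a square root of \<open>y\<close> is mapped to \<open>y\<close>.\<close>

lemma root_surj:
  assumes "a \<in> \<Phi>" "y \<noteq> 0"
  obtains t where "t \<in> T" "a t = y"
proof -
  obtain x where x: "x ^ 2 = y" using nth_root_exists[of 2 y] by auto
  then have "x \<noteq> 0" using assms(2) by auto
  moreover have "pairing a (cr a) = 2"
    using root_datum assms(1) by (simp add: reduced_root_datum_def)
  ultimately have "a (cr a x) = y"
    using character_cocharacter[OF root_character[OF assms(1)] coroot[OF assms(1)], of x] x by simp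
  then show thesis
    using that cocharacterD(1)[OF coroot[OF assms(1)] \<open>x \<noteq> 0\<close>] by blast
qed

section \<open>Parametrized root subgroups\<close>

definition pt :: "'l \<Rightarrow> 'l point" where
  "pt x = (\<lambda>i. if i = 0 then x else 0)"

lemma pt_Ga: "pt x \<in> carrier Ga"
  by (simp add: pt_def Ga_def affine_space_def)

lemma root_subgroup:
  assumes "a \<in> \<Phi>"
  obtains U where "is_root_subgroup G T a U" "equivariant_Ga K G T a U (u a)"
  using assms realized unfolding realization_def by blast

context
  fixes a U
  assumes eq: "equivariant_Ga K G T a U (u a)"
begin

lemma u_hom: "(\<lambda>z. u a (z 0)) \<in> hom Ga (G\<lparr>carrier := U\<rparr>)"
  using eq by (simp add: equivariant_Ga_def alg_iso_def alg_hom_def)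

lemma U_subset: "U \<subseteq> carrier G"
  using eq subgroup.subset by (auto simp: equivariant_Ga_def closed_subgroup_def)

lemma u_in_U: "u a x \<in> U"
proof -
  have "(\<lambda>z. u a (z 0)) (pt x) \<in> U"
    using u_hom pt_Ga[of x] by (auto simp: hom_def)
  then show ?thesis by (simp add: pt_def)
qed

lemma u_range: "U = range (u a)"
proof
  obtain g where g: "g \<in> hom (G\<lparr>carrier := U\<rparr>) Ga" "\<forall>y\<in>U. u a (g y 0) = y"
    using eq by (auto simp: equivariant_Ga_def alg_iso_def alg_hom_def)
  then show "U \<subseteq> range (u a)" by (metis rangeI subsetI)
  show "range (u a) \<subseteq> U" using u_in_U by blast
qed

lemma u_add_aux: "u a (x + y) = u a x \<otimes> u a y"
proof -
  have "u a ((pt x \<otimes>\<^bsub>Ga\<^esub> pt y) 0) = u a (pt x 0) \<otimes> u a (pt y 0)"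
    using u_hom pt_Ga[of x] pt_Ga[of y] by (auto simp: hom_def)
  then show ?thesis by (simp add: Ga_def pt_def)
qed

lemma u_inj_aux: "u a x = u a y \<Longrightarrow> x = y"
proof -
  assume xy: "u a x = u a y"
  obtain g where "\<forall>x\<in>carrier Ga. g (u a (x 0)) = x"
    using eq by (auto simp: equivariant_Ga_def alg_iso_def)
  from this[rule_format, OF pt_Ga[of x]] this[rule_format, OF pt_Ga[of y]] have "pt x = pt y"
    using xy by (simp add: pt_def)
  then show "x = y" by (metis pt_def)
qed

lemma u_conj_aux: "t \<in> T \<Longrightarrow> conjugate t (u a x) = u a (a t * x)"
  using eq by (simp add: equivariant_Ga_def conjugate_def)

end

lemma u_closed: "a \<in> \<Phi> \<Longrightarrow> u a x \<in> carrier G"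
  by (erule root_subgroup) (rule subsetD[OF U_subset u_in_U])

lemma u_add: "a \<in> \<Phi> \<Longrightarrow> u a (x + y) = u a x \<otimes> u a y"
  by (erule root_subgroup) (rule u_add_aux)

lemma u_inj: "a \<in> \<Phi> \<Longrightarrow> u a x = u a y \<longleftrightarrow> x = y"
  by (erule root_subgroup) (auto dest: u_inj_aux)

lemma u_conj: "a \<in> \<Phi> \<Longrightarrow> t \<in> T \<Longrightarrow> conjugate t (u a x) = u a (a t * x)"
  by (erule root_subgroup) (rule u_conj_aux)

lemma u_zero: "a \<in> \<Phi> \<Longrightarrow> u a 0 = \<one>"
  using u_add[of a 0 0] u_closed[of a 0] by (simp add: l_cancel_one)

lemma u_inv: "a \<in> \<Phi> \<Longrightarrow> inv (u a x) = u a (- x)"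
  using u_add[of a "- x" x] u_closed u_zero by (simp add: inv_equality)

text \<open>All structure is transported through the inner automorphism of \<open>n\<close>, using
  that \<open>t n\<close> equals \<open>n\<close> times the conjugate of \<open>t\<close> by
  \<open>inv n\<close>. Regularity holds over the whole field, as \<open>n\<close> need not be
  rational; \<open>is_root_subgroup\<close> asks for no more.\<close>

lemma conj_equivariant:
  assumes n: "n \<in> normT" and a: "a \<in> \<Phi>" and U: "equivariant_Ga K G T a U (u a)"
  shows "equivariant_Ga UNIV G T (cact n a) (conjugate n ` U) (\<lambda>x. conjugate n (u a x))"
proof -
  note nG = normT_closed[OF n]
  note UG = subsetD[OF U_subset[OF U]]
  have Usub: "subgroup U G" and Uclosed: "zariski_closed U"
    using U by (auto simp: equivariant_Ga_def closed_subgroup_def)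
  \<comment> \<open>Described as a preimage under conjugation by \<open>inv n\<close>, the set is
    Zariski closed by \<open>zariski_closed_vimage\<close>.\<close>
  have V: "conjugate n ` U = {x \<in> carrier G. conjugate (inv n) x \<in> U}"
  proof (intro equalityI subsetI)
    fix x assume "x \<in> {x \<in> carrier G. conjugate (inv n) x \<in> U}"
    then show "x \<in> conjugate n ` U"
      using nG by (intro image_eqI[of _ _ "conjugate (inv n) x"]) auto
  qed (use nG UG in auto)
  have reg: "regular_map UNIV (carrier G) (conjugate m)" if "m \<in> carrier G" for m
    using regular_map_conj[OF alg that inv_closed[OF that]] by (simp add: conjugate_def[abs_def])
  have "subgroup (conjugate n ` U) G"
  proof (rule subgroupI)
    show "conjugate n ` U \<noteq> {}" using subgroup.one_closed[OF Usub] by blast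
    show "inv x \<in> conjugate n ` U" if "x \<in> conjugate n ` U" for x
      using that nG UG conjugate_inv subgroup.m_inv_closed[OF Usub] by (smt (verit) image_iff)
    show "x \<otimes> y \<in> conjugate n ` U" if "x \<in> conjugate n ` U" "y \<in> conjugate n ` U" for x y
      using that nG UG conjugate_mult subgroup.m_closed[OF Usub] by (smt (verit) image_iff)
  qed (use nG UG in auto)
  moreover have "zariski_closed (conjugate n ` U)"
    unfolding V using alg Uclosed reg nG
    by (intro zariski_closed_vimage) (auto simp: affine_alg_group_def)
  moreover have "alg_iso UNIV Ga (G\<lparr>carrier := conjugate n ` U\<rparr>) (\<lambda>z. conjugate n (u a (z 0)))"
  proof -
    have iso: "alg_iso K Ga (G\<lparr>carrier := U\<rparr>) (\<lambda>z. u a (z 0))"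
      using U by (simp add: equivariant_Ga_def)
    then have "regular_map K (carrier Ga) (\<lambda>z. u a (z 0))"
      by (simp add: alg_iso_def alg_hom_def)
    then have ureg: "regular_map UNIV (carrier Ga) (\<lambda>z. u a (z 0))"
      by (rule regular_map_mono) simp
    obtain g where g: "g \<in> hom (G\<lparr>carrier := U\<rparr>) Ga" "regular_map K U g"
      "\<And>x. x \<in> carrier Ga \<Longrightarrow> g (u a (x 0)) = x" "\<And>y. y \<in> U \<Longrightarrow> u a (g y 0) = y"
      using iso by (auto simp: alg_iso_def alg_hom_def)
    have 1: "alg_hom UNIV Ga (G\<lparr>carrier := conjugate n ` U\<rparr>) (\<lambda>z. conjugate n (u a (z 0)))"
      unfolding alg_hom_def
    proof
      show "(\<lambda>z. conjugate n (u a (z 0))) \<in> hom Ga (G\<lparr>carrier := conjugate n ` U\<rparr>)"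
        using nG u_in_U[OF U] by (auto simp: hom_def Ga_def u_add a u_closed conjugate_mult)
      show "regular_map UNIV (carrier Ga) (\<lambda>z. conjugate n (u a (z 0)))"
        by (rule regular_map_compose[OF ureg reg[OF nG]]) (simp add: u_closed a)
    qed
    have 2: "alg_hom UNIV (G\<lparr>carrier := conjugate n ` U\<rparr>) Ga (\<lambda>y. g (conjugate (inv n) y))"
      unfolding alg_hom_def
    proof
      show "(\<lambda>y. g (conjugate (inv n) y)) \<in> hom (G\<lparr>carrier := conjugate n ` U\<rparr>) Ga"
        using g(1) nG by (auto simp: hom_def V conjugate_mult)
      have "regular_map UNIV (conjugate n ` U) (conjugate (inv n))"
        using regular_map_subset[OF reg[OF inv_closed[OF nG]]] V by blast
      then have "regular_map UNIV (conjugate n ` U) (\<lambda>y. g (conjugate (inv n) y))"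
        by (rule regular_map_compose[OF _ regular_map_mono[OF g(2)]]) (auto simp: V)
      then show "regular_map UNIV (carrier (G\<lparr>carrier := conjugate n ` U\<rparr>)) (\<lambda>y. g (conjugate (inv n) y))"
        by simp
    qed
    have 3: "g (conjugate (inv n) (conjugate n (u a (x 0)))) = x" if "x \<in> carrier Ga" for x
      using that g(3) nG u_closed[OF a] by simp
    have 4: "conjugate n (u a (g (conjugate (inv n) y) 0)) = y" if "y \<in> conjugate n ` U" for y
      using that g(4) nG by (auto simp: V)
    show ?thesis
      unfolding alg_iso_def using 1 2 3 4
      by (intro conjI exI[of _ "\<lambda>y. g (conjugate (inv n) y)"]) auto
  qed
  moreover have "t \<otimes> conjugate n (u a x) \<otimes> inv t = conjugate n (u a (cact n a t * x))" if t: "t \<in> T" for t x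
  proof -
    have t': "conjugate (inv n) t \<in> T" using normT_conj n t by simp
    have "t \<otimes> conjugate n (u a x) \<otimes> inv t = conjugate (n \<otimes> conjugate (inv n) t) (u a x)"
      using nG T_closed[OF t] u_closed[OF a, of x]
      by (simp add: conjugate_def m_assoc inv_mult_group inv_cancel)
    also have "\<dots> = conjugate n (conjugate (conjugate (inv n) t) (u a x))"
      using nG T_closed[OF t'] u_closed[OF a, of x] by (simp add: conjugate_comp)
    also have "\<dots> = conjugate n (u a (cact n a t * x))"
      using t t' by (simp add: u_conj a cact_def)
    finally show ?thesis .
  qed
  ultimately show ?thesis
    by (simp add: equivariant_Ga_def closed_subgroup_def)
qed

text \<open>Uniqueness of the root subgroup identifies the conjugate of \<open>U\<close> with the
  subgroup of \<open>cact n a\<close>. The resulting change of parameter commutes with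
  multiplication by all values of that root, which by \<open>root_surj\<close> are all nonzero
  scalars, so it is multiplication by its value at \<open>1\<close>.\<close>

lemma conj_root_subgroup:
  assumes n: "n \<in> normT" and a: "a \<in> \<Phi>" and b: "cact n a \<in> \<Phi>"
  shows "\<exists>c. c \<noteq> 0 \<and> (\<forall>x. conjugate n (u a x) = u (cact n a) (c * x))"
proof -
  let ?b = "cact n a"
  note nG = normT_closed[OF n]
  obtain U where U: "equivariant_Ga K G T a U (u a)" using root_subgroup[OF a] by blast
  obtain U' where U': "is_root_subgroup G T ?b U'" "equivariant_Ga K G T ?b U' (u ?b)"
    using root_subgroup[OF b] by blast
  have "\<exists>v. equivariant_Ga UNIV G T ?b (conjugate n ` U) v"
    by (rule exI, rule conj_equivariant[OF n a U])
  then have "conjugate n ` U = U'"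
    by (rule iffD1[OF spec[OF U'(1)[unfolded is_root_subgroup_def]]])
  then have "conjugate n ` U = range (u ?b)"
    using u_range[OF U'(2)] by simp
  then have "conjugate n (u a x) \<in> range (u ?b)" for x
    using imageI[OF u_in_U[OF U], of "conjugate n"] by simp
  then have "\<exists>\<phi>. \<forall>x. conjugate n (u a x) = u ?b (\<phi> x)"
    by (intro choice) auto
  then obtain \<phi> where \<phi>: "\<And>x. conjugate n (u a x) = u ?b (\<phi> x)"
    by auto
  have scale: "\<phi> (?b t * x) = ?b t * \<phi> x" if t: "t \<in> T" for t x
  proof -
    have "conjugate n (u a (?b t * x)) = conjugate t (conjugate n (u a x))"
      using conj_equivariant[OF n a U] t by (simp add: equivariant_Ga_def conjugate_def)
    then show ?thesis using t b by (simp add: \<phi> u_conj u_inj)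
  qed
  have "\<phi> x = \<phi> 1 * x" for x
  proof (cases "x = 0")
    case True
    have "u ?b (\<phi> 0) = u ?b 0" using \<phi>[of 0] nG a b by (simp add: u_zero)
    then show ?thesis using True b by (simp add: u_inj)
  next
    case False
    then obtain t where "t \<in> T" "?b t = x" using root_surj[OF b] by blast
    then show ?thesis using scale[of t 1] by simp
  qed
  moreover have "\<phi> 1 \<noteq> 0"
  proof
    assume "\<phi> 1 = 0"
    then have "conjugate n (u a 1) = conjugate n (u a 0)"
      using \<phi>[of 1] nG a b by (simp add: u_zero)
    then have "u a 1 = u a 0"
      using conjugate_conjugate_inv(2)[OF nG u_closed[OF a]] by metis
    then show False using a by (simp add: u_inj)
  qed
  ultimately show ?thesis using \<phi> by metis
qed

end

subsection \<open>Conjugates of coroots and of the representatives of reflections\<close>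

context realized_group
begin

section \<open>Rank one: a root together with its negative\<close>

lemma T_commutes_u:
  assumes "b \<in> \<Phi>" "t \<in> T" "b t = 1"
  shows "t \<otimes> u b x = u b x \<otimes> t"
  using u_conj[OF assms(1,2), of x] assms u_closed T_closed conjugate_eq_self_iff by simp

text \<open>An element of \<open>T\<close> on which \<open>b\<close> takes a value other than
  \<open>1\<close> commutes with everything in \<open>T\<close>, yet it rescales the parameter
  \<open>x\<close>.\<close>

lemma u_in_T_imp_zero:
  assumes b: "b \<in> \<Phi>" and x: "u b x \<in> T"
  shows "x = 0"
proof -
  obtain g :: 'l where g: "g \<notin> {0, 1}"
    using ex_new_if_finite[OF infinite_UNIV_alg_closed, of "{0, 1}"] by blast
  then obtain t where t: "t \<in> T" "b t = g" using root_surj[OF b, of g] by blast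
  have "u b (g * x) = u b x"
    using u_conj[OF b t(1), of x] T_conj[OF t(1) x] t(2) by simp
  then have "(g - 1) * x = 0" using b by (simp add: u_inj algebra_simps)
  then show ?thesis using g by simp
qed

lemma triple_normT: "b \<in> \<Phi> \<Longrightarrow> x \<noteq> 0 \<Longrightarrow> triple b x \<in> normT"
  by (subst triple_eq) (auto intro: normT_mult subsetD[OF T_subset_normT] cocharacterD(1)[OF coroot] rep_normT)

lemma cact_triple:
  assumes b: "b \<in> \<Phi>" and x: "x \<noteq> 0"
  shows "cact (triple b x) b = neg b"
proof -
  have t: "cr b x \<in> T" using cocharacterD(1)[OF coroot[OF b] x] .
  then have "cact (triple b x) b = cact (cr b x) (cact (rep b) b)"
    using b x T_subset_normT rep_normT by (simp add: triple_eq[OF b x] cact_mult subset_iff)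
  then show ?thesis
    using t b by (simp add: cact_T cact_rep_self cact_one root_ext neg_root)
qed

text \<open>If \<open>d\<close> were different from \<open>1 / c\<close>, then conjugation by a suitable \<open>u b y\<close> would map
  \<open>u (-b) x\<close> to \<open>u (-b) (x / (1 + x))\<close>, up to a factor in the kernel of \<open>b\<close>, for all but two \<open>x\<close>;
  but \<open>x / (1 + x)\<close> is not additive.\<close>

lemma rank_one_normalizer:
  assumes b: "b \<in> \<Phi>" and c: "c \<noteq> 0"
    and m: "u b c \<otimes> u (neg b) (- d) \<otimes> u b c \<in> normT"
    and mb: "cact (u b c \<otimes> u (neg b) (- d) \<otimes> u b c) b = neg b"
  shows "d = inverse c"
proof (rule ccontr)
  assume "d \<noteq> inverse c"
  define e where "e = inverse c - d"
  have e: "e \<noteq> 0" using \<open>d \<noteq> inverse c\<close> by (simp add: e_def)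
  let ?m = "u b c \<otimes> u (neg b) (- d) \<otimes> u b c"
  let ?m' = "triple b c"
  \<comment> \<open>Both \<open>?m\<close> and \<open>?m'\<close> send \<open>b\<close> to
    \<open>neg b\<close>, so \<open>z\<close> normalizes \<open>T\<close> and fixes
    \<open>b\<close>. The factors \<open>u b c\<close> in the middle cancel, leaving a conjugate of
    \<open>u (neg b) e\<close>.\<close>
  define z where "z = inv ?m' \<otimes> ?m"
  note nb = neg_root[OF b]
  note ub = u_closed[OF b] and un = u_closed[OF nb]
  have bchar: "b \<in> characters G T" by (rule root_character[OF b])
  have "z = u b (- c) \<otimes> (u (neg b) (inverse c) \<otimes> u (neg b) (- d)) \<otimes> u b c"
    unfolding z_def root_triple_def using ub un
    by (simp add: inv_mult_group u_inv[OF b] u_inv[OF nb] m_assoc)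
      (simp add: m_assoc[symmetric] u_add[OF b, symmetric] u_zero[OF b])
  then have z: "z = conjugate (u b (- c)) (u (neg b) e)"
    by (simp add: e_def u_add[OF nb, symmetric] conjugate_def u_inv[OF b])
  have m'N: "?m' \<in> normT" by (rule triple_normT[OF b c])
  have zN: "z \<in> normT" unfolding z_def by (intro normT_mult normT_inv m m'N)
  have zG: "z \<in> carrier G" by (rule normT_closed[OF zN])
  have "cact (inv ?m') (cact ?m' b) = b"
    using m'N by (simp add: cact_mult[symmetric] normT_inv normT_closed cact_one root_ext b)
  then have zb: "cact z b = b"
    unfolding z_def using m m'N by (simp add: cact_mult normT_inv mb cact_triple[OF b c])
  \<comment> \<open>For \<open>t\<close> with \<open>b t = \<beta>\<close>, the commutator \<sigma>
    of \<open>z\<close> and \<open>t\<close> lies in \<open>T\<close>, and \<open>b\<close> is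
    \<open>1\<close> on it because \<open>z\<close> fixes \<open>b\<close>. It relates
    \<open>z\<close> to its conjugate by \<open>t\<close>; conjugating that relation by
    \<open>u b (c * \<beta>)\<close>, which commutes with \<sigma>, gives the claim.\<close>
  have step1: "\<exists>\<sigma>\<in>T. b \<sigma> = 1 \<and> conjugate (u b (c * (\<beta> - 1))) (u (neg b) e) = \<sigma> \<otimes> u (neg b) (e / \<beta>)"
    if \<beta>: "\<beta> \<noteq> 0" for \<beta>
  proof -
    obtain t where t: "t \<in> T" "b t = \<beta>" using root_surj[OF b \<beta>] by blast
    note tG = T_closed[OF t(1)]
    define \<sigma> where "\<sigma> = conjugate z t \<otimes> inv t"
    have zt: "conjugate z t \<in> T" by (rule normT_conj(1)[OF zN t(1)])
    have \<sigma>: "\<sigma> \<in> T" unfolding \<sigma>_def by (intro T_mult T_inv zt t)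
    note \<sigma>G = T_closed[OF \<sigma>]
    have "b (conjugate z t) = b t" using cact_conj[OF zN t(1), of b] zb by simp
    then have b\<sigma>: "b \<sigma> = 1"
      using characterD(2)[OF bchar zt T_inv[OF t(1)]] character_inv[OF bchar t(1)] t(2) \<beta>
      by (simp add: \<sigma>_def)
    have "\<sigma> \<otimes> conjugate t z = z"
      unfolding \<sigma>_def using tG zG by (simp add: conjugate_def m_assoc inv_cancel)
    moreover have "conjugate t z = conjugate (u b (- (c * \<beta>))) (u (neg b) (e / \<beta>))"
    proof -
      have "conjugate t z = conjugate (conjugate t (u b (- c))) (conjugate t (u (neg b) e))"
        unfolding z conjugate_def using tG ub un by (simp add: m_assoc inv_mult_group inv_cancel)
      then show ?thesis
        using t by (simp add: u_conj[OF b] u_conj[OF nb] chr_neg_apply field_simps)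
    qed
    ultimately have eq: "\<sigma> \<otimes> conjugate (u b (- (c * \<beta>))) (u (neg b) (e / \<beta>)) = conjugate (u b (- c)) (u (neg b) e)"
      using z by simp
    have "conjugate (u b (c * (\<beta> - 1))) (u (neg b) e) = conjugate (u b (c * \<beta>)) (conjugate (u b (- c)) (u (neg b) e))"
      using ub un by (simp add: conjugate_comp[symmetric] u_add[OF b, symmetric] algebra_simps)
    also have "\<dots> = conjugate (u b (c * \<beta>)) \<sigma> \<otimes> conjugate (u b (c * \<beta>)) (conjugate (u b (- (c * \<beta>))) (u (neg b) (e / \<beta>)))"
      using ub un \<sigma>G by (simp add: eq[symmetric] conjugate_mult)
    also have "conjugate (u b (c * \<beta>)) \<sigma> = \<sigma>"
      using T_commutes_u[OF b \<sigma> b\<sigma>] ub \<sigma>G by (simp add: conjugate_eq_self_iff)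
    also have "conjugate (u b (c * \<beta>)) (conjugate (u b (- (c * \<beta>))) (u (neg b) (e / \<beta>))) = u (neg b) (e / \<beta>)"
      using ub un by (simp add: u_inv[OF b, symmetric])
    finally show ?thesis using \<sigma> b\<sigma> by blast
  qed
  let ?y = "u b (c * e)"
  \<comment> \<open>This is \<open>step1\<close> for \<open>\<beta> = 1 + x\<close>, conjugated by
    an element \<open>t\<close> with \<open>b t = e / x\<close>. The rescaling makes the conjugating
    element \<open>?y\<close> independent of \<open>x\<close>.\<close>
  have step2: "\<exists>\<sigma>\<in>T. b \<sigma> = 1 \<and> conjugate ?y (u (neg b) x) = \<sigma> \<otimes> u (neg b) (x / (1 + x))"
    if x: "x \<noteq> 0" "1 + x \<noteq> 0" for x
  proof -
    obtain t where t: "t \<in> T" "b t = e / x" using root_surj[OF b, of "e / x"] e x by auto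
    note tG = T_closed[OF t(1)]
    obtain \<sigma> where \<sigma>: "\<sigma> \<in> T" "b \<sigma> = 1"
      "conjugate (u b (c * x)) (u (neg b) e) = \<sigma> \<otimes> u (neg b) (e / (1 + x))"
      using step1[OF x(2)] by auto
    have scaled: "conjugate t (u b (c * x)) = ?y" "conjugate t (u (neg b) (e * w)) = u (neg b) (x * w)" for w
      using t x e by (simp_all add: u_conj[OF b] u_conj[OF nb] chr_neg_apply mult.commute)
    have "conjugate ?y (u (neg b) x) = conjugate (conjugate t (u b (c * x))) (conjugate t (u (neg b) e))"
      using scaled(1) scaled(2)[of 1] by simp
    also have "\<dots> = conjugate t (conjugate (u b (c * x)) (u (neg b) e))"
      unfolding conjugate_def using tG ub un by (simp add: m_assoc inv_mult_group inv_cancel)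
    also have "\<dots> = conjugate t \<sigma> \<otimes> conjugate t (u (neg b) (e / (1 + x)))"
      using \<sigma> tG un T_closed by (simp add: conjugate_mult)
    also have "\<dots> = \<sigma> \<otimes> u (neg b) (x / (1 + x))"
      using T_conj[OF t(1) \<sigma>(1)] scaled(2)[of "inverse (1 + x)"] by (simp add: divide_inverse)
    finally show ?thesis using \<sigma> by blast
  qed
  \<comment> \<open>The excluded values keep \<open>step2\<close> applicable to \<open>x\<close>,
    \<open>y\<close> and \<open>x + y\<close>, and keep \<open>x * y * (2 + (x + y))\<close> nonzero
    for the final contradiction.\<close>
  obtain x :: 'l where x: "x \<notin> {0, - 1}"
    using ex_new_if_finite[OF infinite_UNIV_alg_closed, of "{0, - 1}"] by blast
  obtain y :: 'l where y: "y \<notin> {0, - 1, - x, - (1 + x), - (2 + x)}"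
    using ex_new_if_finite[OF infinite_UNIV_alg_closed, of "{0, - 1, - x, - (1 + x), - (2 + x)}"] by blast
  have nz: "x \<noteq> 0" "1 + x \<noteq> 0" "y \<noteq> 0" "1 + y \<noteq> 0" "x + y \<noteq> 0" "1 + (x + y) \<noteq> 0" "2 + (x + y) \<noteq> 0"
    using x y by (auto simp only: add.assoc[symmetric] add_eq_0_iff insert_iff)
  obtain \<sigma>1 where \<sigma>1: "\<sigma>1 \<in> T" "b \<sigma>1 = 1" "conjugate ?y (u (neg b) x) = \<sigma>1 \<otimes> u (neg b) (x / (1 + x))"
    using step2[of x] nz by blast
  obtain \<sigma>2 where \<sigma>2: "\<sigma>2 \<in> T" "b \<sigma>2 = 1" "conjugate ?y (u (neg b) y) = \<sigma>2 \<otimes> u (neg b) (y / (1 + y))"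
    using step2[of y] nz by blast
  obtain \<sigma>3 where \<sigma>3: "\<sigma>3 \<in> T" "b \<sigma>3 = 1"
    "conjugate ?y (u (neg b) (x + y)) = \<sigma>3 \<otimes> u (neg b) ((x + y) / (1 + (x + y)))"
    using step2[of "x + y"] nz by blast
  let ?f = "\<lambda>x. x / (1 + x)"
  note \<sigma>G = T_closed[OF \<sigma>1(1)] T_closed[OF \<sigma>2(1)] T_closed[OF \<sigma>3(1)]
  have comm: "u (neg b) (?f x) \<otimes> \<sigma>2 = \<sigma>2 \<otimes> u (neg b) (?f x)"
    using T_commutes_u[OF nb \<sigma>2(1)] \<sigma>2 by (simp add: chr_neg_apply)
  \<comment> \<open>Conjugation by \<open>?y\<close> is a homomorphism, so its value at the
    parameter \<open>x + y\<close> is computed in two ways; all torus factors can be collected on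
    one side.\<close>
  have "\<sigma>3 \<otimes> u (neg b) (?f (x + y)) = (\<sigma>1 \<otimes> u (neg b) (?f x)) \<otimes> (\<sigma>2 \<otimes> u (neg b) (?f y))"
    using \<sigma>1(3) \<sigma>2(3) \<sigma>3(3) ub un by (simp add: u_add[OF nb] conjugate_mult)
  also have "\<dots> = \<sigma>1 \<otimes> (u (neg b) (?f x) \<otimes> \<sigma>2) \<otimes> u (neg b) (?f y)"
    using \<sigma>G un by (simp add: m_assoc)
  also have "\<dots> = (\<sigma>1 \<otimes> \<sigma>2) \<otimes> u (neg b) (?f x + ?f y)"
    unfolding comm using \<sigma>G un by (simp add: m_assoc u_add[OF nb])
  finally have "inv (\<sigma>1 \<otimes> \<sigma>2) \<otimes> \<sigma>3 \<otimes> u (neg b) (?f (x + y)) = u (neg b) (?f x + ?f y)"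
    using \<sigma>G un by (simp add: m_assoc inv_cancel inv_mult_group)
  then have "inv (\<sigma>1 \<otimes> \<sigma>2) \<otimes> \<sigma>3 = u (neg b) (?f x + ?f y) \<otimes> u (neg b) (- ?f (x + y))"
    using \<sigma>G un by (simp add: inv_solve_right u_inv[OF nb, symmetric])
  then have "u (neg b) (?f x + ?f y - ?f (x + y)) = inv (\<sigma>1 \<otimes> \<sigma>2) \<otimes> \<sigma>3"
    by (simp add: u_add[OF nb, symmetric])
  then have "u (neg b) (?f x + ?f y - ?f (x + y)) \<in> T"
    using \<sigma>1(1) \<sigma>2(1) \<sigma>3(1) by (simp add: T_mult T_inv)
  then have "?f x + ?f y - ?f (x + y) = 0"
    by (rule u_in_T_imp_zero[OF nb])
  then have "(x * (1 + y) + y * (1 + x)) * (1 + (x + y)) = (x + y) * ((1 + x) * (1 + y))"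
    using nz by (simp add: add_frac_eq frac_eq_eq)
  moreover have "(x * (1 + y) + y * (1 + x)) * (1 + (x + y)) - (x + y) * ((1 + x) * (1 + y)) =
      x * y * (2 + (x + y))"
    by (simp add: algebra_simps)
  ultimately have "x * y * (2 + (x + y)) = 0"
    by simp
  then show False using nz by simp
qed

text \<open>Conjugation by \<open>n\<close> scales the parameters of \<open>a\<close> and
  \<open>neg a\<close> by constants \<open>c\<close> and \<open>d\<close>. The image of
  \<open>rep a\<close> meets the hypotheses of \<open>rank_one_normalizer\<close>, so
  \<open>d\<close> is the inverse of \<open>c\<close>, which is exactly what the middle factor of a
  triple demands.\<close>

lemma conj_triple:
  assumes n: "n \<in> normT" and a: "a \<in> \<Phi>" and b: "cact n a \<in> \<Phi>"
  shows "\<exists>c. c \<noteq> 0 \<and> (\<forall>x. x \<noteq> 0 \<longrightarrow> conjugate n (triple a x) = triple (cact n a) (c * x))"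
proof -
  let ?b = "cact n a"
  note nG = normT_closed[OF n]
  obtain c where c: "c \<noteq> 0" "\<And>x. conjugate n (u a x) = u ?b (c * x)"
    using conj_root_subgroup[OF n a b] by blast
  have nb: "cact n (neg a) = neg ?b" by (rule cact_neg[OF n])
  then obtain d where d: "\<And>x. conjugate n (u (neg a) x) = u (neg ?b) (d * x)"
    using conj_root_subgroup[OF n neg_root[OF a]] neg_root[OF b] by auto
  have conjugate: "conjugate n (triple a x) = u ?b (c * x) \<otimes> u (neg ?b) (- (d * inverse x)) \<otimes> u ?b (c * x)" for x
    unfolding root_triple_def using nG u_closed a neg_root[OF a] by (simp add: conjugate_mult c(2) d)
  let ?m = "conjugate n (rep a)"
  have m: "?m \<in> normT"
    unfolding conjugate_def by (intro normT_mult n normT_inv rep_normT a)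
  have "cact ?m ?b = cact n (cact (rep a) (cact (inv n) (cact n a)))"
    unfolding conjugate_def using n rep_normT[OF a] by (simp add: cact_mult normT_mult normT_inv)
  also have "cact (inv n) (cact n a) = a"
    using n nG a by (simp add: cact_mult[symmetric] normT_inv cact_one root_ext)
  also have "cact n (cact (rep a) a) = neg ?b"
    using a nb by (simp add: cact_rep_self)
  finally have "cact ?m ?b = neg ?b" .
  then have "d = inverse c"
    using rank_one_normalizer[OF b c(1), of d] m conjugate[of 1] by simp
  then have "conjugate n (triple a x) = triple ?b (c * x)" for x
    using conjugate[of x] by (simp add: root_triple_def)
  then show ?thesis using c(1) by blast
qed

text \<open>In \<open>triple a x = cr a x \<otimes> rep a\<close> the coroot is the quotient of the
  triples at \<open>x\<close> and \<open>1\<close>. Their images are the triples of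
  \<open>cact n a\<close> at \<open>c * x\<close> and \<open>c\<close>, whose quotient is the coroot
  of \<open>cact n a\<close> at \<open>x\<close>; the unknown \<open>c\<close> survives only in the
  torus factor of the second claim.\<close>

lemma conj_coroot_rep:
  assumes n: "n \<in> normT" and a: "a \<in> \<Phi>" and b: "cact n a \<in> \<Phi>"
  shows "x \<noteq> 0 \<Longrightarrow> conjugate n (cr a x) = cr (cact n a) x"
    and "\<exists>t\<in>T. conjugate n (rep a) = t \<otimes> rep (cact n a)"
proof -
  let ?b = "cact n a"
  note nG = normT_closed[OF n]
  obtain c where c: "c \<noteq> 0" "\<And>x. x \<noteq> 0 \<Longrightarrow> conjugate n (triple a x) = triple ?b (c * x)"
    using conj_triple[OF n a b] by blast
  have cra: "cr a x \<in> carrier G" and crb: "cr ?b x \<in> carrier G" if "x \<noteq> 0" for x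
    using cocharacterD(1)[OF coroot] T_closed a b that by auto
  have rep: "conjugate n (rep a) = cr ?b c \<otimes> rep ?b"
    using c(2)[of 1] c(1) triple_eq[OF b, of c] by simp
  then show "\<exists>t\<in>T. conjugate n (rep a) = t \<otimes> rep ?b"
    using cocharacterD(1)[OF coroot[OF b] c(1)] by blast
  assume x: "x \<noteq> 0"
  have "conjugate n (cr a x) \<otimes> conjugate n (rep a) = conjugate n (triple a x)"
    using x a nG cra rep_closed by (simp add: triple_eq[OF a x] conjugate_mult)
  also have "\<dots> = cr ?b x \<otimes> cr ?b c \<otimes> rep ?b"
    using c x triple_eq[OF b, of "c * x"] cocharacterD(2)[OF coroot[OF b], of x c]
    by (simp add: mult.commute)
  also have "\<dots> = cr ?b x \<otimes> conjugate n (rep a)"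
    using x c(1) crb rep_closed[OF b] by (simp add: rep m_assoc)
  finally show "conjugate n (cr a x) = cr ?b x"
    using x nG cra crb rep_closed[OF a] by (simp add: r_cancel)
qed

section \<open>Reflections in the Weyl group\<close>

lemma coroot_square: "a \<in> \<Phi> \<Longrightarrow> cr a (- 1) \<otimes> cr a (- 1) = \<one>"
  using cocharacterD(2)[OF coroot, of a "- 1" "- 1"] cocharacter_one[OF coroot] by simp

text \<open>The inverse of \<open>rep a\<close> is the triple at \<open>-1\<close>, that is
  \<open>cr a (- 1)\<close> times \<open>rep a\<close>, and \<open>cr a (- 1)\<close> is its own
  inverse.\<close>

lemma rep_square:
  assumes a: "a \<in> \<Phi>"
  shows "rep a \<otimes> rep a = cr a (- 1)"
proof -
  note ua = u_closed[OF a] u_closed[OF neg_root[OF a]]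
  have t: "cr a (- 1) \<in> carrier G"
    using cocharacterD(1)[OF coroot[OF a]] T_closed by simp
  have "inv (rep a) = triple a (- 1)"
    unfolding root_triple_def using ua
    by (simp add: inv_mult_group u_inv a neg_root m_assoc)
  also have "\<dots> = cr a (- 1) \<otimes> rep a"
    by (rule triple_eq[OF a]) simp
  finally have "cr a (- 1) \<otimes> (rep a \<otimes> rep a) = \<one>"
    using l_inv[OF rep_closed[OF a]] t rep_closed[OF a] by (simp add: m_assoc)
  then have "cr a (- 1) \<otimes> (rep a \<otimes> rep a) = cr a (- 1) \<otimes> cr a (- 1)"
    using coroot_square[OF a] by simp
  then show ?thesis using t rep_closed[OF a] by simp
qed

lemma s_W: "a \<in> \<Phi> \<Longrightarrow> s a \<in> carrier W"
  by (simp add: s_cls cls_W rep_normK)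

text \<open>The torus element \<open>cr a (- 1)\<close> is rational because it is the square of the
  rational element \<open>rep a\<close>, so it vanishes in the quotient.\<close>

lemma s_square: "a \<in> \<Phi> \<Longrightarrow> s a \<otimes>\<^bsub>W\<^esub> s a = \<one>\<^bsub>W\<^esub>"
proof -
  assume a: "a \<in> \<Phi>"
  have "cr a (- 1) \<in> TK"
    using cocharacterD(1)[OF coroot[OF a], of "- 1"] normK_mult[OF rep_normK rep_normK, OF a a]
    by (simp add: TK_eq rep_square a)
  then show ?thesis
    using a TK_one by (simp add: s_cls cls_mult rep_normK rep_square cls_one cls_TK)
qed

text \<open>The torus factor \<open>t\<close> from \<open>conj_coroot_rep\<close> is a quotient of
  two rational elements, hence lies in \<open>TK\<close> and disappears in the Weyl group.\<close>

lemma s_conj: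
  assumes n: "n \<in> normK" and a: "a \<in> \<Phi>" and b: "cact n a \<in> \<Phi>"
  shows "s (cact n a) \<otimes>\<^bsub>W\<^esub> cls n = cls n \<otimes>\<^bsub>W\<^esub> s a"
proof -
  let ?b = "cact n a"
  note nG = normK_closed[OF n] and rG = rep_closed[OF a] rep_closed[OF b]
  obtain t where t: "t \<in> T" "conjugate n (rep a) = t \<otimes> rep ?b"
    using conj_coroot_rep(2)[OF normK_normT[OF n] a b] by blast
  have "conjugate n (rep a) \<in> normK"
    unfolding conjugate_def by (intro normK_mult n normK_inv rep_normK a)
  moreover have "t = conjugate n (rep a) \<otimes> inv (rep ?b)"
    using t nG rG T_closed by (simp add: m_assoc)
  ultimately have "t \<in> TK"
    using t(1) normK_mult normK_inv rep_normK[OF b] by (simp add: TK_eq)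
  have "n \<otimes> rep a = t \<otimes> (rep ?b \<otimes> n)"
    using conjugate_eq_mult[OF nG rG(1)] t T_closed nG rG by (simp add: m_assoc)
  then have "cls (n \<otimes> rep a) = cls (rep ?b \<otimes> n)"
    using cls_TK_mult[OF \<open>t \<in> TK\<close>] normK_mult[OF rep_normK[OF b] n] by simp
  then show ?thesis
    using n rep_normK a b by (simp add: s_cls cls_mult)
qed

end

subsection \<open>Products of values of the canonical section\<close>

locale sectioned_group = realized_group G K T cr s u
  for G :: "'l::alg_closed_field point monoid" (structure) and K T cr s u +
  fixes \<Delta> :: "'l chr set" and N :: "'l point set \<Rightarrow> 'l point"
  assumes simple: "simple_system G T \<Delta>"
    and canonical: "canonical_section K G T \<Delta> s u N"
begin

section \<open>Positive and simple roots\<close>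

abbreviation Pos :: "'l chr set" where
  "Pos \<equiv> positive_system G T \<Delta>"

lemma simple_root: "a \<in> \<Delta> \<Longrightarrow> a \<in> \<Phi>"
  using simple by (auto simp: simple_system_def)

lemma finite_\<Delta>: "finite \<Delta>"
  using simple by (simp add: simple_system_def)

lemma root_nonzero: "a \<in> \<Phi> \<Longrightarrow> t \<in> T \<Longrightarrow> a t \<noteq> 0"
  by (rule characterD(3)[OF root_character])

lemma Pos_root: "a \<in> Pos \<Longrightarrow> a \<in> \<Phi>"
  by (simp add: positive_system_def)

lemma PosD:
  assumes "a \<in> Pos"
  obtains c :: "'l chr \<Rightarrow> nat" where "\<And>t. t \<in> T \<Longrightarrow> a t = (\<Prod>b\<in>\<Delta>. b t ^ c b)"
proof -
  obtain c :: "'l chr \<Rightarrow> nat" where "a = (\<lambda>t\<in>T. \<Prod>b\<in>\<Delta>. b t ^ c b)"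
    using assms by (auto simp: positive_system_def nonneg_combs_def)
  then show thesis using that[of c] by simp
qed

lemma Pos_or_neg: "a \<in> \<Phi> \<Longrightarrow> a \<in> Pos \<or> neg a \<in> Pos"
  using simple neg_root by (auto simp: simple_system_def positive_system_def)

lemma \<Delta>_independent:
  fixes c :: "'l chr \<Rightarrow> int"
  shows "(\<And>t. t \<in> T \<Longrightarrow> (\<Prod>b\<in>\<Delta>. b t powi c b) = 1) \<Longrightarrow> b \<in> \<Delta> \<Longrightarrow> c b = 0"
  using simple unfolding simple_system_def by blast

text \<open>Independence of \<Delta> forces the total exponent at \<open>b\<close> to vanish; there
  it is \<open>c b + c' b\<close>, a sum of natural numbers. The extra power of \<open>d\<close>
  serves for reflections, and \<open>k = 0\<close> covers the case without it.\<close>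

lemma coefficients_zero:
  fixes c c' :: "'l chr \<Rightarrow> nat" and k :: int
  assumes "\<And>t. t \<in> T \<Longrightarrow> (\<Prod>b\<in>\<Delta>. b t ^ c b) * (\<Prod>b\<in>\<Delta>. b t ^ c' b) * d t powi k = 1"
    and "d \<in> \<Delta> \<or> k = 0" and b: "b \<in> \<Delta>" "b \<noteq> d \<or> k = 0"
  shows "c b = 0"
proof -
  let ?e = "\<lambda>b. int (c b) + int (c' b) + (if b = d then k else 0)"
  have "(\<Prod>b\<in>\<Delta>. b t powi ?e b) = 1" if t: "t \<in> T" for t
  proof -
    have "(\<Prod>b\<in>\<Delta>. b t powi ?e b) = (\<Prod>b\<in>\<Delta>. b t ^ c b * b t ^ c' b * (if b = d then b t powi k else 1))"
      using root_nonzero[OF simple_root t] by (intro prod.cong) (auto simp: power_int_add)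
    also have "\<dots> = (\<Prod>b\<in>\<Delta>. b t ^ c b) * (\<Prod>b\<in>\<Delta>. b t ^ c' b) * (if d \<in> \<Delta> then d t powi k else 1)"
      by (simp add: prod.distrib finite_\<Delta>)
    also have "\<dots> = 1" using assms(1)[OF t] assms(2) by auto
    finally show ?thesis .
  qed
  then have "?e b = 0"
    using \<Delta>_independent[of ?e b] b(1) by blast
  then show ?thesis using b(2) by auto
qed

text \<open>If \<open>a\<close> and its negative were both nonnegative combinations, all
  coefficients would be zero and \<open>a\<close> the trivial character, which is not a
  root.\<close>

lemma Pos_neg_disjoint:
  assumes a: "a \<in> Pos"
  shows "neg a \<notin> Pos"
proof
  assume "neg a \<in> Pos"
  then obtain c' where c': "\<And>t. t \<in> T \<Longrightarrow> neg a t = (\<Prod>b\<in>\<Delta>. b t ^ c' b)" by (rule PosD) blast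
  obtain c where c: "\<And>t. t \<in> T \<Longrightarrow> a t = (\<Prod>b\<in>\<Delta>. b t ^ c b)" using a by (rule PosD) blast
  have "c b = 0" if "b \<in> \<Delta>" for b
  proof (rule coefficients_zero[of c c' b 0])
    show "(\<Prod>b\<in>\<Delta>. b t ^ c b) * (\<Prod>b\<in>\<Delta>. b t ^ c' b) * b t powi 0 = 1" if "t \<in> T" for t
      using c[OF that] c'[OF that] root_nonzero[OF Pos_root[OF a] that] that
      by (simp add: chr_neg_apply flip: c c')
  qed (use that in auto)
  then have "a t = 1" if "t \<in> T" for t using c[OF that] by simp
  then have "a = (\<lambda>t\<in>T. 1)"
    using root_ext[OF Pos_root[OF a]] by (auto simp: extensional_def fun_eq_iff)
  then show False using Pos_root[OF a] by (simp add: roots_def)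
qed

lemma simple_Pos: "a \<in> \<Delta> \<Longrightarrow> a \<in> Pos"
proof -
  assume a: "a \<in> \<Delta>"
  have "(\<Prod>b\<in>\<Delta>. b t ^ (if b = a then 1 else 0)) = a t" for t
  proof -
    have "(\<Prod>b\<in>\<Delta>. b t ^ (if b = a then 1 else 0)) = (\<Prod>b\<in>\<Delta>. if b = a then b t else 1)"
      by (intro prod.cong) auto
    then show ?thesis using a by (simp add: finite_\<Delta>)
  qed
  then have "a = (\<lambda>t\<in>T. \<Prod>b\<in>\<Delta>. b t ^ (if b = a then 1 else 0))"
    using root_ext[OF simple_root[OF a]] by (auto simp: extensional_def fun_eq_iff)
  then show ?thesis
    unfolding positive_system_def nonneg_combs_def
    by (intro IntI CollectI exI) (rule simple_root[OF a])
qed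

text \<open>The reflection changes only the coefficient at \<open>a\<close>. If the image were
  negative, all other coefficients of \<open>b\<close> would vanish, so \<open>b\<close> would be
  proportional to \<open>a\<close>, contrary to reducedness.\<close>

lemma cact_simple_Pos:
  assumes a: "a \<in> \<Delta>" and b: "b \<in> Pos" and "b \<noteq> a"
  shows "cact (rep a) b \<in> Pos"
proof (rule ccontr)
  assume neg: "cact (rep a) b \<notin> Pos"
  have a\<Phi>: "a \<in> \<Phi>" and b\<Phi>: "b \<in> \<Phi>" using a b simple_root Pos_root by auto
  let ?k = "- pairing b (cr a)"
  have refl: "cact (rep a) b = chr_reflection T a (cr a) b"
    by (rule cact_rep[OF a\<Phi> root_character[OF b\<Phi>]])
  then have "cact (rep a) b \<in> \<Phi>" using reflection_root a\<Phi> b\<Phi> by simp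
  then have "neg (cact (rep a) b) \<in> Pos" using neg Pos_or_neg by blast
  then obtain c' where c': "\<And>t. t \<in> T \<Longrightarrow> neg (cact (rep a) b) t = (\<Prod>b\<in>\<Delta>. b t ^ c' b)"
    by (rule PosD) blast
  obtain c where c: "\<And>t. t \<in> T \<Longrightarrow> b t = (\<Prod>b\<in>\<Delta>. b t ^ c b)" using b by (rule PosD) blast
  have c0: "c d = 0" if "d \<in> \<Delta>" "d \<noteq> a" for d
  proof (rule coefficients_zero[of c c' a ?k])
    fix t assume t: "t \<in> T"
    define p where "p = a t powi ?k"
    have "p \<noteq> 0" using root_nonzero[OF a\<Phi> t] by (simp add: p_def)
    moreover have "neg (cact (rep a) b) t = inverse (b t * p)"
      using t by (simp add: refl chr_neg_apply chr_reflection_def p_def)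
    ultimately show "(\<Prod>b\<in>\<Delta>. b t ^ c b) * (\<Prod>b\<in>\<Delta>. b t ^ c' b) * a t powi ?k = 1"
      using root_nonzero[OF b\<Phi> t]
      by (simp add: c[OF t, symmetric] c'[OF t, symmetric] p_def[symmetric] field_simps)
  qed (use that a in auto)
  \<comment> \<open>The exponents \<open>1\<close> and \<open>int (c a)\<close> fit the
    proportionality clause of \<open>reduced_root_datum\<close> with \<open>m = 1\<close>.\<close>
  have "b t powi 1 = a t powi int (c a)" if t: "t \<in> T" for t
  proof -
    have "b t = (\<Prod>d\<in>\<Delta>. if d = a then d t ^ c d else 1)"
      unfolding c[OF t] using c0 by (intro prod.cong) auto
    then show ?thesis using a by (simp add: finite_\<Delta>)
  qed
  then have "b = a \<or> b = neg a"
    using root_datum a\<Phi> b\<Phi> unfolding reduced_root_datum_def by (metis one_neq_zero)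
  then show False
    using \<open>b \<noteq> a\<close> b Pos_neg_disjoint simple_Pos[OF a] by blast
qed

section \<open>Words in the representatives and the canonical section\<close>

abbreviation nword :: "'l chr list \<Rightarrow> 'l point" where
  "nword \<equiv> group_word G rep"

lemma nword_normK: "as \<in> lists \<Delta> \<Longrightarrow> nword as \<in> normK"
  by (induction as rule: list.induct) (auto simp: normK_one normK_mult rep_normK simple_root)

lemma word_cls: "as \<in> lists \<Delta> \<Longrightarrow> group_word W s as = cls (nword as)"
  by (induction as rule: list.induct)
    (auto simp: cls_one s_cls simple_root cls_mult rep_normK nword_normK in_lists_conv_set)

lemma cact_nword_root: "as \<in> lists \<Delta> \<Longrightarrow> a \<in> \<Phi> \<Longrightarrow> cact (nword as) a \<in> \<Phi>"
proof (induction as rule: list.induct)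
  case (Cons b bs)
  then have "b \<in> \<Phi>" "bs \<in> lists \<Delta>" using simple_root by auto
  with Cons show ?case
    by (simp add: cact_mult rep_normT normK_normT nword_normK cact_rep root_character reflection_root)
qed (simp add: cact_one root_ext)

text \<open>The equivalence in \<open>canonical_section\<close>, read from right to left, makes
  every reduced expression compute \<open>N w\<close>; this is where independence of the expression
  enters.\<close>

lemma section_word:
  assumes "reduced_expression W s \<Delta> w as"
  shows "N w = nword as"
proof -
  have "w \<in> carrier W"
    using reduced_expressionD(1,2)[OF assms] word_cls nword_normK cls_W by metis
  then show ?thesis using canonical assms unfolding canonical_section_def by blast
qed

text \<open>Generation by the simple reflections is read off from \<open>canonical_section\<close>
  at \<open>n = N w\<close>.\<close>

lemma reduced_expression_exists:
  "w \<in> carrier W \<Longrightarrow> \<exists>as. reduced_expression W s \<Delta> w as"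
  using canonical unfolding canonical_section_def by blast

lemma section_normK: "w \<in> carrier W \<Longrightarrow> N w \<in> normK"
  and section_cls: "w \<in> carrier W \<Longrightarrow> cls (N w) = w"
  using reduced_expression_exists[of w] section_word reduced_expressionD(1,2) nword_normK word_cls
  by metis+

lemma weyl_act_section: "w \<in> carrier W \<Longrightarrow> weyl_act G T w a = cact (N w) a"
  using weyl_act_cls section_normK section_cls by metis

text \<open>The representative \<open>N w\<close> is a word in the \<open>rep a\<close> for simple
  \<open>a\<close>, each of which acts as a reflection preserving the roots.\<close>

lemma weyl_act_root: "w \<in> carrier W \<Longrightarrow> a \<in> \<Phi> \<Longrightarrow> weyl_act G T w a \<in> \<Phi>"
  using reduced_expression_exists[of w] section_word reduced_expressionD(1) cact_nword_root
    weyl_act_section by metis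

sublocale R: reflection_action W \<Phi> Pos \<Delta> neg s "weyl_act G T"
proof (intro reflection_action.intro W_group reflection_action_axioms.intro)
  show "\<Delta> \<subseteq> Pos" using simple_Pos by blast
  show "Pos \<subseteq> \<Phi>" using Pos_root by blast
  show "s a \<in> carrier W" if "a \<in> \<Phi>" for a using that by (rule s_W)
  show "weyl_act G T w a \<in> \<Phi>" if "w \<in> carrier W" "a \<in> \<Phi>" for w a
    using that by (rule weyl_act_root)
  show "weyl_act G T (v \<otimes>\<^bsub>W\<^esub> w) a = weyl_act G T v (weyl_act G T w a)"
    if "v \<in> carrier W" "w \<in> carrier W" "a \<in> \<Phi>" for v w a
  proof -
    have "v \<otimes>\<^bsub>W\<^esub> w = cls (N v \<otimes> N w)"
      using that section_cls section_normK cls_mult by metis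
    then show ?thesis
      using that section_normK
      by (simp add: weyl_act_cls weyl_act_section normK_mult cact_mult normK_normT)
  qed
  show "weyl_act G T \<one>\<^bsub>W\<^esub> a = a" if "a \<in> \<Phi>" for a
    using that by (simp add: cls_one weyl_act_cls normK_one cact_one root_ext)
  show "weyl_act G T w (neg a) = neg (weyl_act G T w a)" if "w \<in> carrier W" "a \<in> \<Phi>" for w a
    using that by (simp add: weyl_act_section cact_neg normK_normT section_normK)
  show "neg a \<in> \<Phi>" if "a \<in> \<Phi>" for a using that by (rule neg_root)
  show "neg (neg a) = a" if "a \<in> \<Phi>" for a using that by (rule neg_neg_root)
  show "neg a \<in> Pos \<longleftrightarrow> a \<notin> Pos" if "a \<in> \<Phi>" for a
    using that Pos_or_neg Pos_neg_disjoint by blast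
  show "weyl_act G T (s a) a = neg a" if "a \<in> \<Delta>" for a
    using simple_root[OF that] by (simp add: s_cls weyl_act_cls rep_normK cact_rep_self)
  show "weyl_act G T (s a) b \<in> Pos" if "a \<in> \<Delta>" "b \<in> Pos" "b \<noteq> a" for a b
    using simple_root[OF that(1)] cact_simple_Pos[OF that] by (simp add: s_cls weyl_act_cls rep_normK)
  show "s a \<otimes>\<^bsub>W\<^esub> s a = \<one>\<^bsub>W\<^esub>" if "a \<in> \<Delta>" for a
    using simple_root[OF that] by (rule s_square)
  show "s (weyl_act G T w a) \<otimes>\<^bsub>W\<^esub> w = w \<otimes>\<^bsub>W\<^esub> s a" if "w \<in> carrier W" "a \<in> \<Phi>" for w a
    using s_conj[OF section_normK[OF that(1)] that(2)] weyl_act_root[OF that]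
    by (simp add: weyl_act_section that section_cls)
  show "\<exists>as. reduced_expression W s \<Delta> w as" if "w \<in> carrier W" for w
    using that by (rule reduced_expression_exists)
qed

text \<open>For a root, being the negative of a positive root and not being positive are the
  same.\<close>

lemma flip_set_eq:
  "v \<in> carrier W \<Longrightarrow> w \<in> carrier W \<Longrightarrow> flip_set G T \<Delta> v w = R.flips v w"
  using R.neg_image_iff weyl_act_root Pos_root by (auto simp: flip_set_def R.flips_def)

text \<open>Formed in \<open>T\<close> rather than \<open>G\<close>, since a product over an
  unordered set asks for commutativity.\<close>

abbreviation coroot_prod :: "'l chr set \<Rightarrow> 'l point" where
  "coroot_prod A \<equiv> finprod (G\<lparr>carrier := T\<rparr>) (\<lambda>a. cr a (- 1)) A"

lemma coroot_T: "a \<in> \<Phi> \<Longrightarrow> cr a (- 1) \<in> T"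
  using cocharacterD(1)[OF coroot] by simp

lemma coroot_prod_T: "A \<subseteq> \<Phi> \<Longrightarrow> coroot_prod A \<in> T"
  using comm_monoid.finprod_closed[OF comm_group.axioms(1)[OF T_comm_group], of "\<lambda>a. cr a (- 1)" A] coroot_T
  by auto

lemma coroot_prod_insert:
  assumes "A \<subseteq> \<Phi>" "a \<in> \<Phi>" "a \<notin> A"
  shows "coroot_prod (insert a A) = coroot_prod A \<otimes> cr a (- 1)"
proof -
  have "finite A"
    using assms(1) root_datum finite_subset by (auto simp: reduced_root_datum_def)
  then have "coroot_prod (insert a A) = cr a (- 1) \<otimes> coroot_prod A"
    using comm_monoid.finprod_insert[OF comm_group.axioms(1)[OF T_comm_group], of A a "\<lambda>a. cr a (- 1)"]
      assms coroot_T by auto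
  then show ?thesis
    using T_comm coroot_T[OF assms(2)] coroot_prod_T[OF assms(1)] by simp
qed

lemma section_mult:
  assumes "reduced_expression W s \<Delta> v as" "w \<in> carrier W"
  shows "N v \<otimes> N w = N (v \<otimes>\<^bsub>W\<^esub> w) \<otimes> coroot_prod (R.flips v w)"
  using assms
proof (induction as arbitrary: v w rule: rev_induct)
  case Nil
  then have v: "v = \<one>\<^bsub>W\<^esub>" using reduced_expressionD(2) by fastforce
  have "N v = \<one>" using section_word[OF Nil(1)] by simp
  moreover have "coroot_prod {} = \<one>"
    using comm_monoid.finprod_empty[OF comm_group.axioms(1)[OF T_comm_group]] by simp
  ultimately show ?case
    using Nil(2) normK_closed[OF section_normK] by (simp add: v R.flips_one)
next
  case (snoc a as)
  have a: "a \<in> \<Delta>" and as: "as \<in> lists \<Delta>"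
    using reduced_expressionD(1)[OF snoc.prems(1)] by auto
  define v' where "v' = group_word W s as"
  have red: "reduced_expression W s \<Delta> v' as"
    unfolding v'_def by (rule R.reduced_snocD[OF snoc.prems(1)])
  have v'a: "weyl_act G T v' a \<in> Pos"
    unfolding v'_def by (rule R.reduced_snoc_pos[OF snoc.prems(1)])
  have v': "v' \<in> carrier W" unfolding v'_def by (rule R.word_closed[OF as])
  have sa: "s a \<in> carrier W" by (rule s_W[OF simple_root[OF a]])
  have v: "v = v' \<otimes>\<^bsub>W\<^esub> s a"
    using reduced_expressionD(2)[OF snoc.prems(1)] R.group_word_append[of as \<Delta> "[a]" s] as a sa
      R.s_simple_closed by (simp add: v'_def)
  have Nv': "N v' \<in> carrier G" by (rule normK_closed[OF section_normK[OF v']])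
  have na: "rep a \<in> carrier G" by (rule rep_closed[OF simple_root[OF a]])
  have Nv: "N v = N v' \<otimes> rep a"
    using section_word[OF snoc.prems(1)] section_word[OF red] as a na
      group_word_append[of as \<Delta> "[a]" rep] rep_closed simple_root by simp
  note w = snoc.prems(2)
  obtain bs where bs: "reduced_expression W s \<Delta> w bs" using reduced_expression_exists[OF w] by blast
  show ?case
  proof (cases "weyl_act G T (inv\<^bsub>W\<^esub> w) a \<in> Pos")
    \<comment> \<open>Here \<open>a # bs\<close> is reduced, so \<open>rep a\<close> is absorbed
      into the section and the induction hypothesis applies with \<open>w\<close> replaced by
      \<open>s a\<close> times \<open>w\<close>.\<close>
    case True
    have "N (s a \<otimes>\<^bsub>W\<^esub> w) = rep a \<otimes> N w"
      using section_word[OF R.reduced_Cons_if_pos[OF bs a True]] section_word[OF bs] by simp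
    then have "N v \<otimes> N w = N v' \<otimes> N (s a \<otimes>\<^bsub>W\<^esub> w)"
      using Nv Nv' na normK_closed[OF section_normK[OF w]] by (simp add: m_assoc)
    also have "\<dots> = N (v' \<otimes>\<^bsub>W\<^esub> (s a \<otimes>\<^bsub>W\<^esub> w)) \<otimes> coroot_prod (R.flips v' (s a \<otimes>\<^bsub>W\<^esub> w))"
      using snoc.IH[OF red] sa w by simp
    also have "\<dots> = N (v \<otimes>\<^bsub>W\<^esub> w) \<otimes> coroot_prod (R.flips v w)"
      using R.flips_move[OF v' w a v'a True] v v' sa w by (simp add: R.m_assoc)
    finally show ?thesis .
  next
    case False
    \<comment> \<open>Now \<open>w\<close> has a reduced word starting with \<open>a\<close>, and
      \<open>w'\<close> is what remains; \<open>v'\<close> and \<open>w'\<close> then satisfy the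
      two positivity conditions of \<open>flips_cancel\<close>.\<close>
    define w' where "w' = s a \<otimes>\<^bsub>W\<^esub> w"
    obtain ds where ds: "reduced_expression W s \<Delta> w (a # ds)" "group_word W s ds = w'"
      unfolding w'_def using R.reduced_Cons_if_neg[OF bs a False] by blast
    have w': "w' \<in> carrier W" using sa w by (simp add: w'_def)
    have w_eq: "w = s a \<otimes>\<^bsub>W\<^esub> w'" using R.s_cancel[OF a w] by (simp add: w'_def)
    have w'a: "weyl_act G T (inv\<^bsub>W\<^esub> w') a \<in> Pos"
      using R.reduced_Cons_pos[OF ds(1)] ds(2) by simp
    let ?b = "weyl_act G T (inv\<^bsub>W\<^esub> w') a"
    have Nw: "N w = rep a \<otimes> N w'"
      using section_word[OF ds(1)] section_word[OF R.reduced_ConsD[OF ds(1)]] ds(2) by simp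
    note n = section_normK[OF w']
    note nG = normK_closed[OF n]
    have b: "?b = cact (inv (N w')) a"
      using cls_inv[OF n] section_cls[OF w'] weyl_act_cls[OF normK_inv[OF n]] by simp
    have b\<Phi>: "?b \<in> \<Phi>" using w'a by (rule Pos_root)
    have "conjugate (inv (N w')) (cr a (- 1)) = cr ?b (- 1)"
      using conj_coroot_rep(1)[OF normK_normT[OF normK_inv[OF n]] simple_root[OF a]] b b\<Phi> by simp
    \<comment> \<open>Moving the coroot value to the right past \<open>N w'\<close> applies the
      inverse of \<open>w'\<close> to its root, by equivariance of coroots.\<close>
    then have swap: "cr a (- 1) \<otimes> N w' = N w' \<otimes> cr ?b (- 1)"
      using nG T_closed[OF coroot_T[OF simple_root[OF a]]]
      by (metis conjugate_def inv_cancel(2) inv_closed inv_inv m_assoc m_closed)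
    have flips: "R.flips v' w' \<subseteq> \<Phi>" using Pos_root by (auto simp: R.flips_def)
    have "N v \<otimes> N w = N v' \<otimes> (rep a \<otimes> rep a \<otimes> N w')"
      using Nv Nw Nv' na nG by (simp add: m_assoc)
    also have "\<dots> = N v' \<otimes> N w' \<otimes> cr ?b (- 1)"
      using swap Nv' nG T_closed[OF coroot_T[OF b\<Phi>]] simple_root[OF a] by (simp add: rep_square m_assoc)
    also have "\<dots> = N (v' \<otimes>\<^bsub>W\<^esub> w') \<otimes> coroot_prod (R.flips v' w') \<otimes> cr ?b (- 1)"
      using snoc.IH[OF red w'] by simp
    also have "\<dots> = N (v' \<otimes>\<^bsub>W\<^esub> w') \<otimes> coroot_prod (insert ?b (R.flips v' w'))"
      using coroot_prod_insert[OF flips b\<Phi> R.flips_cancel(2)[OF v' w' a v'a w'a]]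
        normK_closed[OF section_normK, of "v' \<otimes>\<^bsub>W\<^esub> w'"] v' w'
        T_closed[OF coroot_prod_T[OF flips]] T_closed[OF coroot_T[OF b\<Phi>]] by (simp add: m_assoc)
    also have "insert ?b (R.flips v' w') = R.flips v w"
      using R.flips_cancel(1)[OF v' w' a v'a w'a] v w_eq by simp
    also have "v' \<otimes>\<^bsub>W\<^esub> w' = v \<otimes>\<^bsub>W\<^esub> w"
      using v v' sa w by (simp add: w'_def R.m_assoc)
    finally show ?thesis .
  qed
qed

end

theorem proposition3p1p2:
  fixes K :: "'k::field alg_closure set"
    and G :: "'k alg_closure point monoid"
    and T :: "'k alg_closure point set"
    and \<Delta> :: "'k alg_closure chr set"
    and cr :: "'k alg_closure chr \<Rightarrow> 'k alg_closure cochr"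
    and s :: "'k alg_closure chr \<Rightarrow> 'k alg_closure point set"
    and u :: "'k alg_closure chr \<Rightarrow> 'k alg_closure \<Rightarrow> 'k alg_closure point"
    and N :: "'k alg_closure point set \<Rightarrow> 'k alg_closure point"
  assumes "K = range to_ac"
    and "affine_alg_group K G"
    and "zariski_connected (carrier G)"
    and "reductive G"
    and "split_maximal_torus K G T"
    and "reduced_root_datum G T cr"
    and "\<And>a. a \<in> roots G T \<Longrightarrow> is_weyl_reflection K G T cr a (s a)"
    and "simple_system G T \<Delta>"
    and "realization K G T cr s u"
    and "canonical_section K G T \<Delta> s u N"
    and "v \<in> carrier (weyl_group K G T)"
    and "w \<in> carrier (weyl_group K G T)"
  shows "N v \<otimes>\<^bsub>G\<^esub> N w =
    N (v \<otimes>\<^bsub>weyl_group K G T\<^esub> w) \<otimes>\<^bsub>G\<^esub>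
      finprod (G\<lparr>carrier := T\<rparr>) (\<lambda>a. cr a (- 1)) (flip_set G T \<Delta> v w)"
proof -
  interpret group G using assms(2) by (simp add: affine_alg_group_def)
  interpret sectioned_group G K T cr s u \<Delta> N
  proof
    \<comment> \<open>\<open>K\<close> is the image of the ring homomorphism
      \<open>to_ac\<close>.\<close>
    show "x + y \<in> K" "x * y \<in> K" if "x \<in> K" "y \<in> K" for x y
      using that assms(1) by (auto simp flip: to_ac_add to_ac_mult)
    show "split_torus K G T" using assms(5) by (simp add: split_maximal_torus_def)
  qed (fact assms)+
  obtain as where "reduced_expression W s \<Delta> v as"
    using reduced_expression_exists[OF assms(11)] by blast
  then show ?thesis
    using section_mult assms(11,12) by (simp add: flip_set_eq)
qed

end
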